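(* There exists an algorithm which, given any two finite multi-models $(A,\Phi_1,F_1)$ and $(B,\Phi_2,F_2)$, where $A$ and $B$ are algebras with the same operations (belonging to the same variety of algebras $\Theta$), always terminates and correctly decides whether $(A,\Phi_1,F_1)$ and $(B,\Phi_2,F_2)$ are automorphically equivalent.
   Context: A model is a triple $(D,\Phi,f)$ where $D$ is an algebra in a variety $\Theta$ (possibly multi-sorted, $D=\{D_i : i\in\Gamma\}$ with $\Gamma$ a set of sorts), $\Phi$ is a set of relation symbols, and $f$ is an interpretation of these symbols in $D$: for an $n$-ary $\varphi\in\Phi$, $f(\varphi)\subseteq D^n$ (in the multi-sorted case, $f(\varphi)$ is a subset of the product of sorts $D_{i_1}\times\dots\times D_{i_n}$ given by the type of $\varphi$). A multi-model is a triple $(D,\Phi,F)$ where $D$ is an algebra in a variety $\Theta$ (possibly multi-sorted, $D=\{D_i : i\in\Gamma\}$), $\Phi$ is a set of relation symbols, and $F$ is a set of interpretations of $\Phi$ in $D$. A multi-model is finite if all its data are finite: the sorts, the underlying sets, the operation signature, $\Phi$ and $F$. A finite multi-model is given as input by explicit tables of its operations and of its relations under each interpretation. For a model $(D,\Phi,f)$, $\mathrm{Aut}(f)$ is the group of all bijections $s:D\to D$ (in the multi-sorted case, families $s=(s_i)_{i\in\Gamma}$ of bijections $s_i:D_i\to D_i$) such that for every $n$-ary $\varphi\in\Phi$ and every $(a_1,\dots,a_n)\in f(\varphi)$ one has $(sa_1,\dots,sa_n)\in f(\varphi)$. Two models $(A,\Phi_1,f_1)$ and $(B,\Phi_2,f_2)$,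 with $A,B$ algebras with the same operations in $\Theta$, are automorphically equivalent if there is an isomorphism of algebras $\mu:A\to B$ with $\mathrm{Aut}(f_2)=\mu\,\mathrm{Aut}(f_1)\,\mu^{-1}$. ($\Phi_1$ and $\Phi_2$ need not be related.) Two multi-models $(A,\Phi_1,F_1)$ and $(B,\Phi_2,F_2)$ are automorphically equivalent if there is a bijection $\alpha:F_1\to F_2$, $f\mapsto f^\alpha$, such that for every $f\in F_1$ the models $(A,\Phi_1,f)$ and $(B,\Phi_2,f^\alpha)$ are automorphically equivalent. *)

theory Defs
  imports Main "HOL-Library.FuncSet" "HOL-Library.Nat_Bijection"
begin

section \<open>Many-sorted algebras and varieties\<close>

record ('s, 'o) signature =
  sorts :: "'s set"
  ops :: "'o set"
  arg_sorts :: "'o \<Rightarrow> 's list"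
  res_sort :: "'o \<Rightarrow> 's"

definition is_signature :: "('s, 'o) signature \<Rightarrow> bool" where
  "is_signature \<Sigma> \<longleftrightarrow>
     (\<forall>\<omega>\<in>ops \<Sigma>. set (arg_sorts \<Sigma> \<omega>) \<subseteq> sorts \<Sigma> \<and> res_sort \<Sigma> \<omega> \<in> sorts \<Sigma>)"

record ('s, 'o, 'a) algebra =
  carr :: "'s \<Rightarrow> 'a set"
  op_interp :: "'o \<Rightarrow> 'a list \<Rightarrow> 'a"

definition tuples :: "('s \<Rightarrow> 'a set) \<Rightarrow> 's list \<Rightarrow> 'a list set" where
  "tuples D is = listset (map D is)"

definition is_algebra :: "('s, 'o) signature \<Rightarrow> ('s, 'o, 'a) algebra \<Rightarrow> bool" where
  "is_algebra \<Sigma> A \<longleftrightarrow>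
     (\<forall>\<omega>\<in>ops \<Sigma>. \<forall>xs\<in>tuples (carr A) (arg_sorts \<Sigma> \<omega>). op_interp A \<omega> xs \<in> carr A (res_sort \<Sigma> \<omega>))"

datatype 'o trm = Var nat | App 'o "'o trm list"

inductive has_sort :: "('s, 'o) signature \<Rightarrow> (nat \<rightharpoonup> 's) \<Rightarrow> 'o trm \<Rightarrow> 's \<Rightarrow> bool"
  for \<Sigma> :: "('s, 'o) signature" and X :: "nat \<rightharpoonup> 's" where
  "X x = Some i \<Longrightarrow> has_sort \<Sigma> X (Var x) i"
| "\<omega> \<in> ops \<Sigma> \<Longrightarrow> list_all2 (has_sort \<Sigma> X) ts (arg_sorts \<Sigma> \<omega>) \<Longrightarrow>
     has_sort \<Sigma> X (App \<omega> ts) (res_sort \<Sigma> \<omega>)"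

primrec eval_trm :: "('s, 'o, 'a) algebra \<Rightarrow> (nat \<Rightarrow> 'a) \<Rightarrow> 'o trm \<Rightarrow> 'a" where
  "eval_trm A v (Var x) = v x"
| "eval_trm A v (App \<omega> ts) = op_interp A \<omega> (map (eval_trm A v) ts)"

text \<open>Carriers may be empty, so an identity carries its context of sorted variables explicitly.\<close>

type_synonym ('s, 'o) identity = "(nat \<rightharpoonup> 's) \<times> 'o trm \<times> 'o trm"

definition is_identity :: "('s, 'o) signature \<Rightarrow> ('s, 'o) identity \<Rightarrow> bool" where
  "is_identity \<Sigma> = (\<lambda>(X, t, u). finite (dom X) \<and> ran X \<subseteq> sorts \<Sigma> \<and>
     (\<exists>i. has_sort \<Sigma> X t i \<and> has_sort \<Sigma> X u i))"

definition satisfies :: "('s, 'o, 'a) algebra \<Rightarrow> ('s, 'o) identity \<Rightarrow> bool" where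
  "satisfies A = (\<lambda>(X, t, u). \<forall>v. (\<forall>x i. X x = Some i \<longrightarrow> v x \<in> carr A i) \<longrightarrow>
     eval_trm A v t = eval_trm A v u)"

definition is_variety :: "('s, 'o) signature \<Rightarrow> ('s, 'o, 'a) algebra set \<Rightarrow> bool" where
  "is_variety \<Sigma> \<Theta> \<longleftrightarrow> (\<exists>E. (\<forall>e\<in>E. is_identity \<Sigma> e) \<and>
     \<Theta> = {A. is_algebra \<Sigma> A \<and> (\<forall>e\<in>E. satisfies A e)})"

definition is_iso ::
  "('s, 'o) signature \<Rightarrow> ('s, 'o, 'a) algebra \<Rightarrow> ('s, 'o, 'b) algebra \<Rightarrow> ('s \<Rightarrow> 'a \<Rightarrow> 'b) \<Rightarrow> bool" where
  "is_iso \<Sigma> A B \<mu> \<longleftrightarrow>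
     (\<forall>i\<in>sorts \<Sigma>. bij_betw (\<mu> i) (carr A i) (carr B i)) \<and>
     (\<forall>\<omega>\<in>ops \<Sigma>. \<forall>xs\<in>tuples (carr A) (arg_sorts \<Sigma> \<omega>).
        \<mu> (res_sort \<Sigma> \<omega>) (op_interp A \<omega> xs) = op_interp B \<omega> (map2 \<mu> (arg_sorts \<Sigma> \<omega>) xs))"


section \<open>Models, multi-models and automorphic equivalence\<close>

record ('s, 'r) rel_signature =
  syms :: "'r set"
  rel_type :: "'r \<Rightarrow> 's list"

text \<open>Interpretations are extensional functions on the relation symbols, so that a set of
  interpretations has the intended number of elements.\<close>

type_synonym ('r, 'a) rel_interp = "'r \<Rightarrow> 'a list set"

definition interpretations ::
  "('s, 'o, 'a) algebra \<Rightarrow> ('s, 'r) rel_signature \<Rightarrow> ('r, 'a) rel_interp set" where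
  "interpretations A \<Phi> = (\<Pi>\<^sub>E \<phi>\<in>syms \<Phi>. Pow (tuples (carr A) (rel_type \<Phi> \<phi>)))"

type_synonym ('s, 'o, 'r, 'a) model =
  "('s, 'o, 'a) algebra \<times> ('s, 'r) rel_signature \<times> ('r, 'a) rel_interp"

type_synonym ('s, 'o, 'r, 'a) multi_model =
  "('s, 'o, 'a) algebra \<times> ('s, 'r) rel_signature \<times> ('r, 'a) rel_interp set"

definition is_multi_model ::
  "('s, 'o) signature \<Rightarrow> ('s, 'o, 'r, 'a) multi_model \<Rightarrow> bool" where
  "is_multi_model \<Sigma> = (\<lambda>(A, \<Phi>, F). is_algebra \<Sigma> A \<and>
     (\<forall>\<phi>\<in>syms \<Phi>. set (rel_type \<Phi> \<phi>) \<subseteq> sorts \<Sigma>) \<and> F \<subseteq> interpretations A \<Phi>)"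

definition finite_multi_model ::
  "('s, 'o) signature \<Rightarrow> ('s, 'o, 'r, 'a) multi_model \<Rightarrow> bool" where
  "finite_multi_model \<Sigma> = (\<lambda>(A, \<Phi>, F). is_multi_model \<Sigma> (A, \<Phi>, F) \<and>
     finite (sorts \<Sigma>) \<and> (\<forall>i\<in>sorts \<Sigma>. finite (carr A i)) \<and> finite (ops \<Sigma>) \<and>
     finite (syms \<Phi>) \<and> finite F)"

text \<open>The elements of \<^term>\<open>Aut \<Sigma> (A, \<Phi>, f)\<close> are families of plain bijections: they need not
  preserve the operations of the algebra. They are kept extensional so that equality of such
  sets of families is the intended one.\<close>

definition Aut :: "('s, 'o) signature \<Rightarrow> ('s, 'o, 'r, 'a) model \<Rightarrow> ('s \<Rightarrow> 'a \<Rightarrow> 'a) set" where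
  "Aut \<Sigma> = (\<lambda>(A, \<Phi>, f). {s \<in> \<Pi>\<^sub>E i\<in>sorts \<Sigma>. extensional (carr A i).
     (\<forall>i\<in>sorts \<Sigma>. bij_betw (s i) (carr A i) (carr A i)) \<and>
     (\<forall>\<phi>\<in>syms \<Phi>. \<forall>xs\<in>f \<phi>. map2 s (rel_type \<Phi> \<phi>) xs \<in> f \<phi>)})"

definition conjugate ::
  "('s, 'o) signature \<Rightarrow> ('s, 'o, 'a) algebra \<Rightarrow> ('s, 'o, 'b) algebra \<Rightarrow>
     ('s \<Rightarrow> 'a \<Rightarrow> 'b) \<Rightarrow> ('s \<Rightarrow> 'a \<Rightarrow> 'a) \<Rightarrow> 's \<Rightarrow> 'b \<Rightarrow> 'b" where
  "conjugate \<Sigma> A B \<mu> s =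
     (\<lambda>i\<in>sorts \<Sigma>. \<lambda>b\<in>carr B i. \<mu> i (s i (inv_into (carr A i) (\<mu> i) b)))"

definition aut_equiv ::
  "('s, 'o) signature \<Rightarrow> ('s, 'o, 'r, 'a) model \<Rightarrow> ('s, 'o, 'q, 'b) model \<Rightarrow> bool" where
  "aut_equiv \<Sigma> = (\<lambda>(A, \<Phi>\<^sub>1, f\<^sub>1) (B, \<Phi>\<^sub>2, f\<^sub>2).
     \<exists>\<mu>. is_iso \<Sigma> A B \<mu> \<and> Aut \<Sigma> (B, \<Phi>\<^sub>2, f\<^sub>2) = conjugate \<Sigma> A B \<mu> ` Aut \<Sigma> (A, \<Phi>\<^sub>1, f\<^sub>1))"

definition multi_aut_equiv ::
  "('s, 'o) signature \<Rightarrow> ('s, 'o, 'r, 'a) multi_model \<Rightarrow> ('s, 'o, 'q, 'b) multi_model \<Rightarrow> bool" where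
  "multi_aut_equiv \<Sigma> = (\<lambda>(A, \<Phi>\<^sub>1, F\<^sub>1) (B, \<Phi>\<^sub>2, F\<^sub>2).
     \<exists>\<alpha>. bij_betw \<alpha> F\<^sub>1 F\<^sub>2 \<and> (\<forall>f\<in>F\<^sub>1. aut_equiv \<Sigma> (A, \<Phi>\<^sub>1, f) (B, \<Phi>\<^sub>2, \<alpha> f)))"


section \<open>Explicit tables\<close>

text \<open>Sorts, operation symbols, relation symbols and elements are named by natural numbers in the
  tables. The order in which the entries are listed is arbitrary.\<close>

definition lists_set :: "('a \<Rightarrow> 'b \<Rightarrow> bool) \<Rightarrow> 'a set \<Rightarrow> 'b list \<Rightarrow> bool" where
  "lists_set R S ts \<longleftrightarrow> (\<exists>xs. distinct xs \<and> set xs = S \<and> list_all2 R xs ts)"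

type_synonym carrier_entry = "nat \<times> nat list"
type_synonym operation_entry = "nat \<times> nat list \<times> nat \<times> (nat list \<times> nat) list"
type_synonym symbol_entry = "nat \<times> nat list"
type_synonym relation_entry = "nat \<times> nat list list"

type_synonym multi_model_table =
  "carrier_entry list \<times> operation_entry list \<times> symbol_entry list \<times> relation_entry list list"

definition carrier_row :: "(nat, nat, nat) algebra \<Rightarrow> nat \<Rightarrow> carrier_entry \<Rightarrow> bool" where
  "carrier_row A i = (\<lambda>(j, ds). j = i \<and> lists_set (=) (carr A i) ds)"

definition operation_row ::
  "(nat, nat) signature \<Rightarrow> (nat, nat, nat) algebra \<Rightarrow> nat \<Rightarrow> operation_entry \<Rightarrow> bool" where
  "operation_row \<Sigma> A \<omega> = (\<lambda>(\<omega>', is, j, t). \<omega>' = \<omega> \<and> is = arg_sorts \<Sigma> \<omega> \<and> j = res_sort \<Sigma> \<omega> \<and>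
     lists_set (\<lambda>xs r. r = (xs, op_interp A \<omega> xs)) (tuples (carr A) (arg_sorts \<Sigma> \<omega>)) t)"

definition symbol_row :: "(nat, nat) rel_signature \<Rightarrow> nat \<Rightarrow> symbol_entry \<Rightarrow> bool" where
  "symbol_row \<Phi> \<phi> = (\<lambda>r. r = (\<phi>, rel_type \<Phi> \<phi>))"

definition relation_row :: "(nat, nat) rel_interp \<Rightarrow> nat \<Rightarrow> relation_entry \<Rightarrow> bool" where
  "relation_row f \<phi> = (\<lambda>(\<psi>, ts). \<psi> = \<phi> \<and> lists_set (=) (f \<phi>) ts)"

definition tabulates ::
  "(nat, nat) signature \<Rightarrow> (nat, nat, nat, nat) multi_model \<Rightarrow> multi_model_table \<Rightarrow> bool" where
  "tabulates \<Sigma> = (\<lambda>(A, \<Phi>, F) (ct, ot, st, its).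
     lists_set (carrier_row A) (sorts \<Sigma>) ct \<and>
     lists_set (operation_row \<Sigma> A) (ops \<Sigma>) ot \<and>
     lists_set (symbol_row \<Phi>) (syms \<Phi>) st \<and>
     lists_set (\<lambda>f. lists_set (relation_row f) (syms \<Phi>)) F its)"

lemma lists_set_exists:
  assumes "finite S" and "\<And>x. x \<in> S \<Longrightarrow> \<exists>t. R x t"
  shows "\<exists>ts. lists_set R S ts"
proof -
  obtain xs where xs: "distinct xs" "set xs = S"
    using finite_distinct_list[OF assms(1)] by blast
  obtain g where "\<And>x. x \<in> S \<Longrightarrow> R x (g x)"
    using assms(2) by metis
  then have "list_all2 R xs (map g xs)"
    using xs by (auto simp: list_all2_conv_all_nth)
  then show ?thesis
    using xs unfolding lists_set_def by blast
qed

lemma finite_tuples: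
  assumes "\<And>i. i \<in> set is \<Longrightarrow> finite (D i)"
  shows "finite (tuples D is)"
  using assms by (induction "is") (auto simp: tuples_def set_Cons_def finite_image_set2)

lemma tabulates_exists:
  assumes "is_signature \<Sigma>" and "finite_multi_model \<Sigma> M"
  shows "\<exists>T. tabulates \<Sigma> M T"
proof -
  obtain A \<Phi> F where M: "M = (A, \<Phi>, F)" by (cases M)
  have fin: "finite (tuples (carr A) is)" if "set is \<subseteq> sorts \<Sigma>" for "is"
    using assms(2) that by (intro finite_tuples) (auto simp: M finite_multi_model_def)
  have fin_rel: "finite (f \<phi>)" if "f \<in> F" "\<phi> \<in> syms \<Phi>" for f \<phi>
  proof -
    have "f \<phi> \<subseteq> tuples (carr A) (rel_type \<Phi> \<phi>)"
      using assms(2) that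
      by (fastforce simp: M finite_multi_model_def is_multi_model_def interpretations_def)
    moreover have "set (rel_type \<Phi> \<phi>) \<subseteq> sorts \<Sigma>"
      using assms(2) that by (auto simp: M finite_multi_model_def is_multi_model_def)
    ultimately show ?thesis using fin finite_subset by blast
  qed
  have "\<exists>r. carrier_row A i r" if "i \<in> sorts \<Sigma>" for i
  proof -
    have "finite (carr A i)"
      using assms(2) that by (simp add: M finite_multi_model_def)
    then obtain ds where "lists_set (=) (carr A i) ds"
      using lists_set_exists[of "carr A i" "(=)"] by blast
    then show ?thesis by (auto simp: carrier_row_def)
  qed
  then have "\<exists>ct. lists_set (carrier_row A) (sorts \<Sigma>) ct"
    using assms(2) by - (rule lists_set_exists, simp_all add: M finite_multi_model_def)
  moreover have "\<exists>r. operation_row \<Sigma> A \<omega> r" if "\<omega> \<in> ops \<Sigma>" for \<omega>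
  proof -
    have "finite (tuples (carr A) (arg_sorts \<Sigma> \<omega>))"
      using assms(1) that fin by (simp add: is_signature_def)
    then obtain t where
      "lists_set (\<lambda>xs r. r = (xs, op_interp A \<omega> xs)) (tuples (carr A) (arg_sorts \<Sigma> \<omega>)) t"
      using lists_set_exists[of _ "\<lambda>xs r. r = (xs, op_interp A \<omega> xs)"] by blast
    then show ?thesis by (auto simp: operation_row_def)
  qed
  then have "\<exists>ot. lists_set (operation_row \<Sigma> A) (ops \<Sigma>) ot"
    using assms(2) by - (rule lists_set_exists, simp_all add: M finite_multi_model_def)
  moreover have "\<exists>st. lists_set (symbol_row \<Phi>) (syms \<Phi>) st"
    using assms(2) by - (rule lists_set_exists, simp_all add: M finite_multi_model_def symbol_row_def)
  moreover have "\<exists>r. relation_row f \<phi> r" if "f \<in> F" "\<phi> \<in> syms \<Phi>" for f \<phi>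
  proof -
    have "finite (f \<phi>)"
      using fin_rel that by blast
    then obtain ts where "lists_set (=) (f \<phi>) ts"
      using lists_set_exists[of "f \<phi>" "(=)"] by blast
    then show ?thesis by (auto simp: relation_row_def)
  qed
  then have "\<exists>t. lists_set (relation_row f) (syms \<Phi>) t" if "f \<in> F" for f
    using assms(2) that by - (rule lists_set_exists, simp_all add: M finite_multi_model_def)
  then have "\<exists>its. lists_set (\<lambda>f. lists_set (relation_row f) (syms \<Phi>)) F its"
    using assms(2) by - (rule lists_set_exists, simp_all add: M finite_multi_model_def)
  ultimately show ?thesis
    by (auto simp: M tabulates_def)
qed

definition encode_pair :: "('a \<Rightarrow> nat) \<Rightarrow> ('b \<Rightarrow> nat) \<Rightarrow> 'a \<times> 'b \<Rightarrow> nat" where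
  "encode_pair e d = (\<lambda>(x, y). prod_encode (e x, d y))"

definition encode_list :: "('a \<Rightarrow> nat) \<Rightarrow> 'a list \<Rightarrow> nat" where
  "encode_list e xs = list_encode (map e xs)"

definition encode_table :: "multi_model_table \<Rightarrow> nat" where
  "encode_table =
     encode_pair (encode_list (encode_pair id (encode_list id)))
    (encode_pair (encode_list (encode_pair id (encode_pair (encode_list id) (encode_pair id
                    (encode_list (encode_pair (encode_list id) id))))))
    (encode_pair (encode_list (encode_pair id (encode_list id)))
                 (encode_list (encode_list (encode_pair id (encode_list (encode_list id)))))))"


section \<open>Algorithms: partial recursive functions\<close>

datatype recfn =
    Zero
  | Succ
  | Proj nat
  | Comp recfn "recfn list"
  | PrimRec recfn recfn
  | Mu recfn

text \<open>\<^term>\<open>computes p xs y\<close>: the evaluation of \<^term>\<open>p\<close> at \<^term>\<open>xs\<close> terminates with value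
  \<^term>\<open>y\<close>. In primitive recursion and minimisation the distinguished argument comes first.\<close>

inductive computes :: "recfn \<Rightarrow> nat list \<Rightarrow> nat \<Rightarrow> bool" where
  Zero: "computes Zero xs 0"
| Succ: "computes Succ [x] (Suc x)"
| Proj: "k < length xs \<Longrightarrow> computes (Proj k) xs (xs ! k)"
| Comp: "list_all2 (\<lambda>g y. computes g xs y) gs ys \<Longrightarrow> computes p ys z \<Longrightarrow> computes (Comp p gs) xs z"
| PrimRec_0: "computes p xs y \<Longrightarrow> computes (PrimRec p q) (0 # xs) y"
| PrimRec_Suc: "computes (PrimRec p q) (n # xs) r \<Longrightarrow> computes q (n # r # xs) y \<Longrightarrow>
     computes (PrimRec p q) (Suc n # xs) y"
| Mu: "computes p (n # xs) 0 \<Longrightarrow> (\<And>m. m < n \<Longrightarrow> \<exists>k. computes p (m # xs) (Suc k)) \<Longrightarrow>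
     computes (Mu p) xs n"

inductive_cases computes_ZeroE: "computes Zero xs z"
inductive_cases computes_SuccE: "computes Succ xs z"
inductive_cases computes_ProjE: "computes (Proj k) xs z"
inductive_cases computes_CompE: "computes (Comp p gs) xs z"
inductive_cases computes_PrimRec_0E: "computes (PrimRec p q) (0 # xs) z"
inductive_cases computes_PrimRec_SucE: "computes (PrimRec p q) (Suc n # xs) z"
inductive_cases computes_MuE: "computes (Mu p) xs z"

lemma computes_deterministic:
  "computes p xs y \<Longrightarrow> computes p xs z \<Longrightarrow> y = z"
proof (induction arbitrary: z rule: computes.induct)
  case (Zero xs)
  then show ?case by (rule computes_ZeroE) simp
next
  case (Succ x)
  then show ?case by (rule computes_SuccE) simp
next
  case (Proj k xs)
  from Proj.prems show ?case by (rule computes_ProjE) simp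
next
  case (Comp xs gs ys p w)
  from Comp.prems obtain ys' where
    ys': "list_all2 (\<lambda>g y. computes g xs y) gs ys'" "computes p ys' z"
    by (rule computes_CompE)
  have "ys = ys'"
  proof (rule nth_equalityI)
    show "length ys = length ys'"
      using Comp.IH(1) ys'(1) by (simp add: list_all2_conv_all_nth)
    show "ys ! i = ys' ! i" if "i < length ys" for i
      using Comp.IH(1) ys'(1) that by (simp add: list_all2_conv_all_nth)
  qed
  then show ?case using Comp.IH(2) ys'(2) by simp
next
  case (PrimRec_0 p xs y q)
  from PrimRec_0.prems show ?case
    by (rule computes_PrimRec_0E) (rule PrimRec_0.IH)
next
  case (PrimRec_Suc p q n xs r y)
  from PrimRec_Suc.prems obtain r' where
    r': "computes (PrimRec p q) (n # xs) r'" "computes q (n # r' # xs) z"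
    by (rule computes_PrimRec_SucE)
  have "r = r'"
    using r'(1) by (rule PrimRec_Suc.IH(1))
  then show ?case using PrimRec_Suc.IH(2) r'(2) by simp
next
  case (Mu p n xs)
  from Mu.prems have z: "computes p (z # xs) 0" "\<And>m. m < z \<Longrightarrow> \<exists>k. computes p (m # xs) (Suc k)"
    by (rule computes_MuE, blast)+
  show ?case
  proof (cases n z rule: linorder_cases)
    case less
    then show ?thesis using Mu.IH(1) z(2) by (metis nat.distinct(1))
  next
    case greater
    then show ?thesis using Mu.IH(2) z(1) by (metis nat.distinct(1))
  qed
qed

end

theory Submission
  imports Defs
begin

text \<open>All data of the two tables, the names of sorts and of elements as well as the lengths of the
  lists, are smaller than $N = x + y + 1$, where $x$ and $y$ are the codes of the tables. Hence the
  candidates for the isomorphism $\mu$, for the families of permutations and for the bijection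
  $\alpha$ can all be read off the base $N$ expansions of the numbers below $N^{N^2}$, and automorphic
  equivalence becomes an arithmetical formula with computably bounded quantifiers. The equality
  $\mathrm{Aut}(f_2) = \mu\,\mathrm{Aut}(f_1)\,\mu^{-1}$ is expressed pointwise: whenever
  $t \mu = \mu s$ for families $s$ and $t$, $s$ is an automorphism iff $t$ is.\<close>

section \<open>Closure properties of computable functions\<close>

text \<open>The deciding program is never written out: connectives, bounded quantifiers and searches
  are shown to preserve total computability at a fixed arity, and the program arises from the shape
  of the formula. The obstacle is to bound the quantifiers over families. A family read off from
  digits is not controlled outside the carriers, whereas \<open>Aut\<close> contains extensional
  families only; hence everything is restated for plain families and shown to depend on their values
  on the carriers alone. Writing t \<mu> = \<mu> s instead of t = \<mu> s \<mu>^-1 avoids coding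
  inverses, and the relation itself supplies the bounds: it makes s map the carriers into
  themselves, and then t does so because \<mu> is onto. Moreover, one structure has many tables. The
  formula therefore consults sets of rows, matched by the names of sorts and symbols, while
  interpretations, which have no names, are addressed by their positions. The exponent N^2 comes
  from storing a family with N rows (sorts) and N columns (elements).\<close>

definition computable :: "nat \<Rightarrow> (nat list \<Rightarrow> nat) \<Rightarrow> bool" where
  "computable n f \<longleftrightarrow> (\<exists>p. \<forall>xs. length xs = n \<longrightarrow> computes p xs (f xs))"

definition decidable :: "nat \<Rightarrow> (nat list \<Rightarrow> bool) \<Rightarrow> bool" where
  "decidable n P \<longleftrightarrow> computable n (\<lambda>xs. of_bool (P xs))"

lemma computable_cong:
  assumes "computable n f" and "\<And>xs. length xs = n \<Longrightarrow> f xs = g xs"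
  shows "computable n g"
  using assms unfolding computable_def by metis

lemma decidable_cong:
  assumes "decidable n P" and "\<And>xs. length xs = n \<Longrightarrow> P xs \<longleftrightarrow> Q xs"
  shows "decidable n Q"
  using assms unfolding decidable_def by (auto elim: computable_cong)

section \<open>Projections, composition and recursion\<close>

lemma computable_nth:
  assumes "i < n"
  shows "computable n (\<lambda>xs. xs ! i)"
  using assms computes.Proj unfolding computable_def by blast

lemma computable_hd: "computable (Suc n) (\<lambda>xs. hd xs)"
proof (rule computable_cong)
  show "computable (Suc n) (\<lambda>xs. xs ! 0)"
    by (rule computable_nth) simp
  show "xs ! 0 = hd xs" if "length xs = Suc n" for xs :: "nat list"
    using that by (cases xs) auto
qed

lemma computable_compose:
  assumes "computable (length fs) g" and "\<And>f. f \<in> set fs \<Longrightarrow> computable n f"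
  shows "computable n (\<lambda>xs. g (map (\<lambda>f. f xs) fs))"
proof -
  obtain p where p: "\<And>ys. length ys = length fs \<Longrightarrow> computes p ys (g ys)"
    using assms(1) unfolding computable_def by blast
  obtain q where q: "\<And>f xs. f \<in> set fs \<Longrightarrow> length xs = n \<Longrightarrow> computes (q f) xs (f xs)"
    using assms(2) unfolding computable_def by metis
  have "computes (Comp p (map q fs)) xs (g (map (\<lambda>f. f xs) fs))" if "length xs = n" for xs
    using that by (intro computes.Comp[where ys = "map (\<lambda>f. f xs) fs"] p)
      (auto simp: list_all2_conv_all_nth q)
  then show ?thesis unfolding computable_def by blast
qed

lemma map_nth_tl:
  assumes "length xs = Suc n"
  shows "map ((!) xs) [1..<Suc n] = tl xs"
  using assms by (intro nth_equalityI) (auto simp: nth_tl simp del: upt_Suc)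

text \<open>Weakening: a function of the outer environment stays computable under one more binder,
  since the projections 1 to n rebuild \<open>tl xs\<close>.\<close>

lemma computable_tl:
  assumes "computable n f"
  shows "computable (Suc n) (\<lambda>xs. f (tl xs))"
proof (rule computable_cong)
  let ?fs = "map (\<lambda>i xs. xs ! i) [1..<Suc n]"
  show "computable (Suc n) (\<lambda>xs. f (map (\<lambda>f. f xs) ?fs))"
    using assms by (intro computable_compose) (auto intro!: computable_nth simp del: upt_Suc)
  show "f (map (\<lambda>f. f xs) ?fs) = f (tl xs)" if "length xs = Suc n" for xs
    using map_nth_tl[OF that] by (simp add: comp_def del: upt_Suc)
qed

text \<open>Substitution for the innermost variable. It serves where a quantifier over positions in
  a coded list replaces one over its entries.\<close>

lemma computable_update_hd:
  assumes "computable (Suc n) (\<lambda>xs. F (hd xs) (tl xs))" and "computable (Suc n) g"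
  shows "computable (Suc n) (\<lambda>xs. F (g xs) (tl xs))"
proof (rule computable_cong)
  let ?fs = "g # map (\<lambda>i xs. xs ! i) [1..<Suc n]"
  let ?f = "\<lambda>xs. F (hd xs) (tl xs)"
  show "computable (Suc n) (\<lambda>xs. ?f (map (\<lambda>f. f xs) ?fs))"
    using assms by (intro computable_compose) (auto intro!: computable_nth simp del: upt_Suc)
  show "?f (map (\<lambda>f. f xs) ?fs) = F (g xs) (tl xs)" if "length xs = Suc n" for xs
    using map_nth_tl[OF that] by (simp add: comp_def del: upt_Suc)
qed

lemma computable_compose1:
  assumes "computable 1 (\<lambda>xs. F (hd xs))" and "computable n f"
  shows "computable n (\<lambda>xs. F (f xs))"
  using computable_compose[of "[f]" "\<lambda>xs. F (hd xs)" n] assms by simp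

lemma computable_Suc:
  assumes "computable n f"
  shows "computable n (\<lambda>xs. Suc (f xs))"
proof (rule computable_compose1[OF _ assms])
  have "computes Succ xs (Suc (hd xs))" if "length xs = 1" for xs
    using that computes.Succ[of "hd xs"] by (cases xs) auto
  then show "computable 1 (\<lambda>xs. Suc (hd xs))" unfolding computable_def by blast
qed

lemma computable_const: "computable n (\<lambda>xs. c)"
proof (induction c)
  case 0
  show ?case unfolding computable_def using computes.Zero by blast
next
  case (Suc c)
  then show ?case by (rule computable_Suc)
qed

text \<open>The step function lives under two further binders: the recursion index comes first and
  the previous value second, as in \<open>PrimRec\<close>.\<close>

lemma computable_rec_nat:
  assumes "computable n g" and "computable (Suc (Suc n)) (\<lambda>ys. h (hd ys) (hd (tl ys)) (tl (tl ys)))"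
    and "computable n f"
  shows "computable n (\<lambda>xs. rec_nat (g xs) (\<lambda>k r. h k r xs) (f xs))"
proof -
  obtain p where p: "\<And>xs. length xs = n \<Longrightarrow> computes p xs (g xs)"
    using assms(1) unfolding computable_def by blast
  obtain q where q: "\<And>ys. length ys = Suc (Suc n) \<Longrightarrow>
      computes q ys (h (hd ys) (hd (tl ys)) (tl (tl ys)))"
    using assms(2) unfolding computable_def by blast
  obtain r where r: "\<And>xs. length xs = n \<Longrightarrow> computes r xs (f xs)"
    using assms(3) unfolding computable_def by blast
  have *: "computes (PrimRec p q) (m # xs) (rec_nat (g xs) (\<lambda>k r. h k r xs) m)"
    if "length xs = n" for m xs
  proof (induction m)
    case 0
    then show ?case using p[OF that] by (simp add: computes.PrimRec_0)
  next
    case (Suc m)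
    then show ?case using q[of "m # _ # xs"] that by (auto intro: computes.PrimRec_Suc)
  qed
  \<comment> \<open>\<open>PrimRec\<close> takes its recursion argument from the front, so
    \<open>f xs\<close> is put there, and the projections hand over the environment
    unchanged.\<close>
  have "computes (Comp (PrimRec p q) (r # map Proj [0..<n])) xs
      (rec_nat (g xs) (\<lambda>k r. h k r xs) (f xs))" if xs: "length xs = n" for xs
  proof (rule computes.Comp)
    have "list_all2 (\<lambda>g y. computes g xs y) (map Proj [0..<n]) xs"
      using xs by (auto simp: list_all2_conv_all_nth intro!: computes.Proj)
    then show "list_all2 (\<lambda>g y. computes g xs y) (r # map Proj [0..<n]) (f xs # xs)"
      using r[OF xs] by simp
    show "computes (PrimRec p q) (f xs # xs) (rec_nat (g xs) (\<lambda>k r. h k r xs) (f xs))"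
      using xs by (rule *)
  qed
  then show ?thesis unfolding computable_def by blast
qed

section \<open>Arithmetic by primitive recursion\<close>

lemma computable_add:
  assumes "computable n f" and "computable n g"
  shows "computable n (\<lambda>xs. f xs + g xs)"
proof (rule computable_cong)
  show "computable n (\<lambda>xs. rec_nat (f xs) (\<lambda>k r. Suc r) (g xs))"
    using assms by (intro computable_rec_nat computable_Suc computable_tl computable_hd)
  have "rec_nat a (\<lambda>k r. Suc r) b = a + b" for a b :: nat
    by (induction b) auto
  then show "rec_nat (f xs) (\<lambda>k r. Suc r) (g xs) = f xs + g xs" for xs .
qed

lemma computable_mult:
  assumes "computable n f" and "computable n g"
  shows "computable n (\<lambda>xs. f xs * g xs)"
proof (rule computable_cong)
  show "computable n (\<lambda>xs. rec_nat 0 (\<lambda>k r. r + f xs) (g xs))"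
    using assms by (intro computable_rec_nat computable_add computable_const computable_tl computable_hd)
  have "rec_nat 0 (\<lambda>k r. r + a) b = a * b" for a b :: nat
    by (induction b) auto
  then show "rec_nat 0 (\<lambda>k r. r + f xs) (g xs) = f xs * g xs" for xs .
qed

lemma computable_power:
  assumes "computable n f" and "computable n g"
  shows "computable n (\<lambda>xs. f xs ^ g xs)"
proof (rule computable_cong)
  show "computable n (\<lambda>xs. rec_nat (Suc 0) (\<lambda>k r. r * f xs) (g xs))"
    using assms by (intro computable_rec_nat computable_mult computable_const computable_tl computable_hd)
  have "rec_nat (Suc 0) (\<lambda>k r. r * a) b = a ^ b" for a b :: nat
    by (induction b) auto
  then show "rec_nat (Suc 0) (\<lambda>k r. r * f xs) (g xs) = f xs ^ g xs" for xs .
qed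

lemma computable_pred:
  assumes "computable n f"
  shows "computable n (\<lambda>xs. f xs - 1)"
proof (rule computable_cong)
  show "computable n (\<lambda>xs. rec_nat 0 (\<lambda>k r. k) (f xs))"
    using assms by (intro computable_rec_nat computable_const computable_hd)
  show "rec_nat 0 (\<lambda>k r. k) (f xs) = f xs - 1" for xs
    by (cases "f xs") auto
qed

lemma computable_diff:
  assumes "computable n f" and "computable n g"
  shows "computable n (\<lambda>xs. f xs - g xs)"
proof (rule computable_cong)
  show "computable n (\<lambda>xs. rec_nat (f xs) (\<lambda>k r. r - 1) (g xs))"
    using assms by (intro computable_rec_nat computable_pred computable_tl computable_hd)
  have "rec_nat a (\<lambda>k r. r - 1) b = a - b" for a b :: nat
    by (induction b) auto
  then show "rec_nat (f xs) (\<lambda>k r. r - 1) (g xs) = f xs - g xs" for xs .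
qed

lemma computable_funpow:
  assumes "computable 1 (\<lambda>xs. F (hd xs))" and "computable n f" and "computable n g"
  shows "computable n (\<lambda>xs. (F ^^ g xs) (f xs))"
proof (rule computable_cong)
  show "computable n (\<lambda>xs. rec_nat (f xs) (\<lambda>k r. F r) (g xs))"
    by (rule computable_rec_nat[OF assms(2) computable_compose1[OF assms(1)] assms(3)])
      (intro computable_tl computable_hd)
  have "rec_nat a (\<lambda>k r. F r) b = (F ^^ b) a" for a b
    by (induction b) auto
  then show "rec_nat (f xs) (\<lambda>k r. F r) (g xs) = (F ^^ g xs) (f xs)" for xs .
qed

section \<open>Connectives, comparisons and bounded quantifiers\<close>

lemma decidable_not:
  assumes "decidable n P"
  shows "decidable n (\<lambda>xs. \<not> P xs)"
  unfolding decidable_def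
  by (rule computable_cong[OF computable_diff[OF computable_const[of n 1] assms[unfolded decidable_def]]]) auto

lemma decidable_and:
  assumes "decidable n P" and "decidable n Q"
  shows "decidable n (\<lambda>xs. P xs \<and> Q xs)"
  unfolding decidable_def
  by (rule computable_cong[OF computable_mult[OF assms[unfolded decidable_def]]]) auto

lemma decidable_or:
  assumes "decidable n P" and "decidable n Q"
  shows "decidable n (\<lambda>xs. P xs \<or> Q xs)"
  by (rule decidable_cong[OF decidable_not[OF decidable_and[OF assms[THEN decidable_not]]]]) auto

lemma decidable_imp:
  assumes "decidable n P" and "decidable n Q"
  shows "decidable n (\<lambda>xs. P xs \<longrightarrow> Q xs)"
  by (rule decidable_cong[OF decidable_or[OF decidable_not[OF assms(1)] assms(2)]]) auto

lemma decidable_iff: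
  assumes "decidable n P" and "decidable n Q"
  shows "decidable n (\<lambda>xs. P xs \<longleftrightarrow> Q xs)"
  by (rule decidable_cong[OF decidable_and[OF decidable_imp[OF assms] decidable_imp[OF assms(2,1)]]]) auto

text \<open>In truncated subtraction g - f is positive iff f < g, and 1 - (1 - d) is the truth value
  of d > 0.\<close>

lemma decidable_less:
  assumes "computable n f" and "computable n g"
  shows "decidable n (\<lambda>xs. f xs < g xs)"
  unfolding decidable_def
  by (rule computable_cong[OF computable_diff[OF computable_const[of n 1]
        computable_diff[OF computable_const[of n 1] computable_diff[OF assms(2,1)]]]]) auto

lemma decidable_eq:
  assumes "computable n f" and "computable n g"
  shows "decidable n (\<lambda>xs. f xs = g xs)"
  by (rule decidable_cong[OF decidable_and[OF decidable_not[OF decidable_less[OF assms]]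
        decidable_not[OF decidable_less[OF assms(2,1)]]]]) auto

text \<open>\<open>Mu\<close> stops at the value 0, so the program searched is that of the negated
  predicate: below the least witness it returns 1, a successor as \<open>computes.Mu\<close>
  demands. The existence assumption makes the search total.\<close>

lemma computable_Least:
  assumes P: "decidable (Suc n) (\<lambda>ys. P (hd ys) (tl ys))"
    and ex: "\<And>xs. length xs = n \<Longrightarrow> \<exists>i. P i xs"
  shows "computable n (\<lambda>xs. LEAST i. P i xs)"
proof -
  obtain p where p: "\<And>ys. length ys = Suc n \<Longrightarrow> computes p ys (of_bool (\<not> P (hd ys) (tl ys)))"
    using decidable_not[OF P] unfolding decidable_def computable_def by blast
  have "computes (Mu p) xs (LEAST i. P i xs)" if xs: "length xs = n" for xs
  proof (rule computes.Mu)
    show "computes p ((LEAST i. P i xs) # xs) 0"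
      using p[of "(LEAST i. P i xs) # xs"] xs LeastI_ex[OF ex[OF xs]] by simp
    show "\<exists>k. computes p (m # xs) (Suc k)" if "m < (LEAST i. P i xs)" for m
      using p[of "m # xs"] xs not_less_Least[OF that] by auto
  qed
  then show ?thesis unfolding computable_def by blast
qed

text \<open>The quantifier is a search for a counterexample in which the bound itself counts as one.
  The search thus halts at the bound at the latest, and the formula holds iff it gets that
  far.\<close>

lemma decidable_All_less:
  assumes b: "computable n b" and P: "decidable (Suc n) (\<lambda>ys. P (hd ys) (tl ys))"
  shows "decidable n (\<lambda>xs. \<forall>i < b xs. P i xs)"
proof (rule decidable_cong)
  let ?m = "\<lambda>xs. LEAST i. \<not> (i < b xs \<and> P i xs)"
  have "computable n ?m"
    using assms by (intro computable_Least decidable_not decidable_and decidable_less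
        computable_hd computable_tl) auto
  then show "decidable n (\<lambda>xs. \<not> ?m xs < b xs)"
    by (intro decidable_not decidable_less b)
  show "\<not> ?m xs < b xs \<longleftrightarrow> (\<forall>i < b xs. P i xs)" for xs
  proof
    assume *: "\<not> ?m xs < b xs"
    show "\<forall>i < b xs. P i xs"
    proof (intro allI impI)
      fix i assume "i < b xs"
      then have "i < ?m xs" using * by simp
      from not_less_Least[OF this] show "P i xs" by blast
    qed
  next
    assume "\<forall>i < b xs. P i xs"
    moreover have "\<not> (?m xs < b xs \<and> P (?m xs) xs)"
      by (rule LeastI[of _ "b xs"]) simp
    ultimately show "\<not> ?m xs < b xs" by blast
  qed
qed

lemma decidable_Ex_less:
  assumes "computable n b" and "decidable (Suc n) (\<lambda>ys. P (hd ys) (tl ys))"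
  shows "decidable n (\<lambda>xs. \<exists>i < b xs. P i xs)"
  by (rule decidable_cong[OF decidable_not[OF decidable_All_less[OF assms(1)
        decidable_not[OF assms(2)]]]]) auto

text \<open>Environments are lists of values, the most recently bound variable first: a term with $n$
  variables under one more binder is a function of $n + 1$ arguments, in which \<^term>\<open>hd\<close> is the
  bound variable and \<^term>\<open>tl\<close> the outer environment. With the rules in this form,
  introduction by the following facts decides any formula with bounded quantifiers.\<close>

lemmas computable_basic =
  computable_const computable_Suc computable_add computable_mult computable_power computable_diff
  decidable_not decidable_and decidable_or decidable_imp decidable_iff decidable_less decidable_eq
  decidable_All_less decidable_Ex_less computable_hd computable_tl

text \<open>The quotient is the least q with f < (q + 1) g. For divisor 0 the first disjunct stops
  the search at 0, the value of \<open>div\<close> there.\<close>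

lemma computable_div:
  assumes "computable n f" and "computable n g"
  shows "computable n (\<lambda>xs. f xs div g xs)"
proof (rule computable_cong)
  show "computable n (\<lambda>xs. LEAST q. g xs = 0 \<or> f xs < Suc q * g xs)"
  proof (rule computable_Least)
    show "decidable (Suc n) (\<lambda>ys. g (tl ys) = 0 \<or> f (tl ys) < Suc (hd ys) * g (tl ys))"
      using assms by (intro computable_basic)
    \<comment> \<open>The witness q = a works because a < (a + 1) b for every positive b.\<close>
    have "\<exists>q. b = 0 \<or> a < Suc q * b" for a b :: nat
      by (rule exI[of _ a]) (cases b, auto)
    then show "\<exists>q. g xs = 0 \<or> f xs < Suc q * g xs" for xs .
  qed
  have "(LEAST q. b = 0 \<or> a < Suc q * b) = a div b" for a b :: nat
  proof (cases "b = 0")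
    case False
    show ?thesis
    proof (rule Least_equality)
      show "b = 0 \<or> a < Suc (a div b) * b"
        using False by (simp add: dividend_less_div_times)
      show "a div b \<le> q" if "b = 0 \<or> a < Suc q * b" for q
        using that False by (metis less_Suc_eq_le less_mult_imp_div_less)
    qed
  qed (simp add: Least_equality)
  then show "(LEAST q. g xs = 0 \<or> f xs < Suc q * g xs) = f xs div g xs" for xs .
qed

lemma computable_mod:
  assumes "computable n f" and "computable n g"
  shows "computable n (\<lambda>xs. f xs mod g xs)"
  by (rule computable_cong[OF computable_diff[OF assms(1) computable_mult[OF computable_div[OF assms] assms(2)]]])
    (simp add: minus_div_mult_eq_mod)


section \<open>Decoding pairs and lists\<close>

abbreviation code_fst :: "nat \<Rightarrow> nat" where
  "code_fst c \<equiv> fst (prod_decode c)"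

abbreviation code_snd :: "nat \<Rightarrow> nat" where
  "code_snd c \<equiv> snd (prod_decode c)"

lemma computable_prod_encode:
  assumes "computable n f" and "computable n g"
  shows "computable n (\<lambda>xs. prod_encode (f xs, g xs))"
  unfolding prod_encode_def triangle_def split
  using assms by (intro computable_basic computable_div)

lemma code_fst_le: "code_fst c \<le> c"
  using le_prod_encode_1[of "code_fst c" "code_snd c"] by simp

lemma code_snd_le: "code_snd c \<le> c"
  using le_prod_encode_2[of "code_snd c" "code_fst c"] by simp

text \<open>The pairing is inverted by search: the other component is at most the code, so it falls
  under a bounded quantifier, and injectivity of the pairing makes the hit unique.\<close>

lemma computable_code_fst:
  assumes "computable n f"
  shows "computable n (\<lambda>xs. code_fst (f xs))"
proof (rule computable_cong)
  have *: "(\<exists>y < Suc c. prod_encode (x, y) = c) \<longleftrightarrow> x = code_fst c" for x c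
    by (metis code_snd_le fst_conv le_imp_less_Suc prod.collapse prod_decode_inverse prod_encode_inverse)
  show "computable n (\<lambda>xs. LEAST x. \<exists>y < Suc (f xs). prod_encode (x, y) = f xs)"
  proof (rule computable_Least)
    show "decidable (Suc n) (\<lambda>ys. \<exists>y < Suc (f (tl ys)). prod_encode (hd ys, y) = f (tl ys))"
      using assms by (intro computable_basic computable_prod_encode)
  qed (simp add: *)
  show "(LEAST x. \<exists>y < Suc (f xs). prod_encode (x, y) = f xs) = code_fst (f xs)" for xs
    by (simp add: * Least_equality)
qed

lemma computable_code_snd:
  assumes "computable n f"
  shows "computable n (\<lambda>xs. code_snd (f xs))"
proof (rule computable_cong)
  have *: "(\<exists>x < Suc c. prod_encode (x, y) = c) \<longleftrightarrow> y = code_snd c" for y c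
    by (metis code_fst_le snd_conv le_imp_less_Suc prod.collapse prod_decode_inverse prod_encode_inverse)
  show "computable n (\<lambda>xs. LEAST y. \<exists>x < Suc (f xs). prod_encode (x, y) = f xs)"
  proof (rule computable_Least)
    show "decidable (Suc n) (\<lambda>ys. \<exists>x < Suc (f (tl ys)). prod_encode (x, hd ys) = f (tl ys))"
      using assms by (intro computable_basic computable_prod_encode)
  qed (simp add: *)
  show "(LEAST y. \<exists>x < Suc (f xs). prod_encode (x, y) = f xs) = code_snd (f xs)" for xs
    by (simp add: * Least_equality)
qed

text \<open>\<open>list_encode\<close> sends a nonempty list to the successor of a pair (head, code
  of the tail), hence the subtraction of 1. At 0, the code of the empty list, the value is 0, in
  line with \<open>tl [] = []\<close>.\<close>

definition code_tl :: "nat \<Rightarrow> nat" where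
  "code_tl c = code_snd (c - 1)"

definition code_nth :: "nat \<Rightarrow> nat \<Rightarrow> nat" where
  "code_nth c k = code_fst ((code_tl ^^ k) c - 1)"

abbreviation code_length :: "nat \<Rightarrow> nat" where
  "code_length c \<equiv> length (list_decode c)"

abbreviation code_set :: "nat \<Rightarrow> nat set" where
  "code_set c \<equiv> set (list_decode c)"

lemma code_tl_list_encode: "code_tl (list_encode xs) = list_encode (tl xs)"
  using code_snd_le[of 0] by (cases xs) (auto simp: code_tl_def)

lemma funpow_code_tl: "(code_tl ^^ k) (list_encode xs) = list_encode (drop k xs)"
  by (induction k) (auto simp: code_tl_list_encode drop_Suc tl_drop)

lemma code_nth_list_encode:
  assumes "k < length xs"
  shows "code_nth (list_encode xs) k = xs ! k"
  unfolding code_nth_def funpow_code_tl using assms by (simp add: Cons_nth_drop_Suc[symmetric])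

lemma code_nth_list_decode:
  assumes "k < code_length c"
  shows "code_nth c k = list_decode c ! k"
  using code_nth_list_encode[OF assms] by simp

text \<open>Only the empty list has code 0, so iterated tails reach 0 exactly when the list is
  exhausted. This makes the length accessible to a search.\<close>

lemma funpow_code_tl_eq_0: "(code_tl ^^ k) c = 0 \<longleftrightarrow> code_length c \<le> k"
proof -
  have "list_encode ys = 0 \<longleftrightarrow> ys = []" for ys
    by (cases ys) auto
  then show ?thesis
    using funpow_code_tl[of k "list_decode c"] by simp
qed

lemma code_length_eq: "code_length c = (LEAST k. (code_tl ^^ k) c = 0)"
  unfolding funpow_code_tl_eq_0 by (rule Least_equality[symmetric]) auto

lemma computable_code_tl:
  assumes "computable n f"
  shows "computable n (\<lambda>xs. code_tl (f xs))"
  unfolding code_tl_def using assms by (intro computable_basic computable_code_snd)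

lemma computable_funpow_code_tl:
  assumes "computable n f" and "computable n g"
  shows "computable n (\<lambda>xs. (code_tl ^^ g xs) (f xs))"
  using assms unfolding One_nat_def
  by (intro computable_funpow computable_code_tl) (auto intro: computable_hd)

lemma computable_code_length:
  assumes "computable n f"
  shows "computable n (\<lambda>xs. code_length (f xs))"
  unfolding code_length_eq
proof (rule computable_Least)
  show "decidable (Suc n) (\<lambda>ys. (code_tl ^^ hd ys) (f (tl ys)) = 0)"
    using assms by (intro computable_basic computable_funpow_code_tl)
  show "\<exists>k. (code_tl ^^ k) (f xs) = 0" for xs
    unfolding funpow_code_tl_eq_0 by blast
qed

lemma computable_code_nth:
  assumes "computable n f" and "computable n g"
  shows "computable n (\<lambda>xs. code_nth (f xs) (g xs))"
  unfolding code_nth_def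
  using assms by (intro computable_basic computable_funpow_code_tl computable_code_fst)

text \<open>The quantifier ranges over positions below the length, and the entry at the position is
  substituted for the bound variable.\<close>

lemma decidable_Ball_code_set:
  assumes "computable n c" and "decidable (Suc n) (\<lambda>ys. P (hd ys) (tl ys))"
  shows "decidable n (\<lambda>xs. \<forall>x \<in> code_set (c xs). P x xs)"
proof (rule decidable_cong)
  have "decidable (Suc n) (\<lambda>ys. P (code_nth (c (tl ys)) (hd ys)) (tl ys))"
    using assms(2) unfolding decidable_def
    by (rule computable_update_hd) (intro computable_code_nth computable_basic assms)
  then show "decidable n (\<lambda>xs. \<forall>k < code_length (c xs). P (code_nth (c xs) k) xs)"
    using assms by (intro computable_basic computable_code_length)
  show "(\<forall>k < code_length (c xs). P (code_nth (c xs) k) xs) \<longleftrightarrow> (\<forall>x \<in> code_set (c xs). P x xs)" for xs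
    by (auto simp: all_set_conv_all_nth code_nth_list_decode)
qed

lemma decidable_Bex_code_set:
  assumes "computable n c" and "decidable (Suc n) (\<lambda>ys. P (hd ys) (tl ys))"
  shows "decidable n (\<lambda>xs. \<exists>x \<in> code_set (c xs). P x xs)"
  by (rule decidable_cong[OF decidable_not[OF decidable_Ball_code_set[OF assms(1)
        decidable_not[OF assms(2)]]]]) auto

lemmas computable_codes =
  computable_code_fst computable_code_snd computable_code_length computable_code_nth
  decidable_Ball_code_set decidable_Bex_code_set

lemma less_list_encode: "x \<in> set xs \<Longrightarrow> x < list_encode xs"
proof (induction xs)
  case (Cons y xs)
  then show ?case
    using le_prod_encode_1[of y "list_encode xs"] le_prod_encode_2[of "list_encode xs" y]
    by (auto intro: le_imp_less_Suc)
qed simp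

lemma code_set_less: "x \<in> code_set c \<Longrightarrow> x < c"
  using less_list_encode[of x "list_decode c"] by simp


section \<open>Numbers as codes of finite families\<close>

text \<open>A table of N rows and N columns stored row by row: row \<open>i\<close> for the sort,
  column \<open>a\<close> for the element.\<close>

definition digit :: "nat \<Rightarrow> nat \<Rightarrow> nat \<Rightarrow> nat \<Rightarrow> nat" where
  "digit N c i a = c div N ^ (i * N + a) mod N"

lemma computable_digit:
  assumes "computable n N" and "computable n c" and "computable n f" and "computable n g"
  shows "computable n (\<lambda>xs. digit (N xs) (c xs) (f xs) (g xs))"
  unfolding digit_def using assms by (intro computable_basic computable_div computable_mod)

text \<open>Values that are not below N are left unspecified, because a family is controlled only on
  the carriers. The induction peels off the lowest digit and applies to the shifted family.\<close>

lemma expansion_exists: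
  assumes "0 < (N::nat)"
  shows "\<exists>c < N ^ n. \<forall>k < n. f k < N \<longrightarrow> c div N ^ k mod N = f k"
proof (induction n arbitrary: f)
  case (Suc n)
  obtain c where c: "c < N ^ n" "\<And>k. k < n \<Longrightarrow> f (Suc k) < N \<Longrightarrow> c div N ^ k mod N = f (Suc k)"
    using Suc[of "\<lambda>k. f (Suc k)"] by blast
  \<comment> \<open>Reduction modulo N keeps \<open>d\<close> below the bound even if
    \<open>f 0\<close> is too large to be a digit.\<close>
  define d where "d = f 0 mod N + N * c"
  have "N * Suc c \<le> N * N ^ n"
    using c(1) by (intro mult_le_mono2) simp
  then have "d < N ^ Suc n"
    using mod_less_divisor[OF assms, of "f 0"] by (simp add: d_def)
  moreover have "d div N = c"
    using assms by (simp add: d_def)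
  then have "d div N ^ Suc k = c div N ^ k" for k
    by (simp add: div_mult2_eq)
  then have "d div N ^ k mod N = f k" if "k < Suc n" "f k < N" for k
    using c(2) that by (cases k) (simp_all add: d_def del: power_Suc)
  ultimately show ?case by blast
qed simp

text \<open>The positions i * N + a with i, a < N lie below N * N, and \<open>div\<close> and
  \<open>mod\<close> recover i and a from them.\<close>

lemma digit_exists:
  assumes "0 < N"
  shows "\<exists>c < N ^ (N * N). \<forall>i < N. \<forall>a < N. \<mu> i a < N \<longrightarrow> digit N c i a = \<mu> i a"
proof -
  obtain c where c: "c < N ^ (N * N)" "\<And>k. k < N * N \<Longrightarrow> \<mu> (k div N) (k mod N) < N \<Longrightarrow>
      c div N ^ k mod N = \<mu> (k div N) (k mod N)"
    using expansion_exists[OF assms, of "N * N" "\<lambda>k. \<mu> (k div N) (k mod N)"] by blast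
  have "digit N c i a = \<mu> i a" if "i < N" "a < N" "\<mu> i a < N" for i a
  proof -
    have "i * N + a < Suc i * N" using that by simp
    also have "\<dots> \<le> N * N" using that by (intro mult_le_mono1) simp
    finally show ?thesis
      using c(2)[of "i * N + a"] that by (simp add: digit_def)
  qed
  then show ?thesis using c(1) by blast
qed


section \<open>Automorphic equivalence in terms of plain families\<close>

text \<open>\<open>Aut\<close> without extensionality, which a family of digits cannot be expected
  to have.\<close>

definition is_aut ::
  "('s, 'o) signature \<Rightarrow> ('s, 'o, 'r, 'a) model \<Rightarrow> ('s \<Rightarrow> 'a \<Rightarrow> 'a) \<Rightarrow> bool" where
  "is_aut \<Sigma> = (\<lambda>(A, \<Phi>, f) s. (\<forall>i\<in>sorts \<Sigma>. bij_betw (s i) (carr A i) (carr A i)) \<and>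
     (\<forall>\<phi>\<in>syms \<Phi>. \<forall>xs\<in>f \<phi>. map2 s (rel_type \<Phi> \<phi>) xs \<in> f \<phi>))"

text \<open>The relation t \<mu> = \<mu> s on the carriers, free of inverses. The clause that s
  stays in the carriers bounds its values and lets \<mu> be cancelled by injectivity.\<close>

definition conj_related ::
  "('s, 'o) signature \<Rightarrow> ('s, 'o, 'a) algebra \<Rightarrow> ('s \<Rightarrow> 'a \<Rightarrow> 'b) \<Rightarrow> ('s \<Rightarrow> 'a \<Rightarrow> 'a) \<Rightarrow>
     ('s \<Rightarrow> 'b \<Rightarrow> 'b) \<Rightarrow> bool" where
  "conj_related \<Sigma> A \<mu> s t \<longleftrightarrow>
     (\<forall>i\<in>sorts \<Sigma>. \<forall>a\<in>carr A i. s i a \<in> carr A i \<and> t i (\<mu> i a) = \<mu> i (s i a))"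

lemma in_tuples_iff:
  "xs \<in> tuples D is \<longleftrightarrow> length xs = length is \<and> (\<forall>k < length is. xs ! k \<in> D (is ! k))"
proof (induction "is" arbitrary: xs)
  case (Cons i "is")
  show ?case
  proof (cases xs)
    case (Cons x ys)
    have "xs \<in> tuples D (i # is) \<longleftrightarrow> x \<in> D i \<and> ys \<in> tuples D is"
      by (auto simp: tuples_def set_Cons_def Cons)
    then show ?thesis
      unfolding Cons.IH by (auto simp: Cons less_Suc_eq_0_disj)
  qed (auto simp: tuples_def set_Cons_def)
qed (auto simp: tuples_def)

section \<open>Invariance under changes outside the carriers\<close>

lemma map2_cong_tuples:
  assumes "xs \<in> tuples D is" and "\<And>i a. i \<in> set is \<Longrightarrow> a \<in> D i \<Longrightarrow> \<mu> i a = \<nu> i a"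
  shows "map2 \<mu> is xs = map2 \<nu> is xs"
  using assms by (intro nth_equalityI) (auto simp: in_tuples_iff)

lemma Aut_iff:
  "s \<in> Aut \<Sigma> (A, \<Phi>, f) \<longleftrightarrow>
     s \<in> (\<Pi>\<^sub>E i\<in>sorts \<Sigma>. extensional (carr A i)) \<and> is_aut \<Sigma> (A, \<Phi>, f) s"
  by (simp add: Aut_def is_aut_def)

text \<open>Operations are applied to tuples over the carriers and, by \<open>is_algebra\<close>,
  return elements of carriers, so only values of \<mu> there enter. This allows \<mu> to be replaced
  by a family of digits.\<close>

lemma is_iso_cong:
  assumes "is_signature \<Sigma>" and "is_algebra \<Sigma> A"
    and eq: "\<And>i a. i \<in> sorts \<Sigma> \<Longrightarrow> a \<in> carr A i \<Longrightarrow> \<mu> i a = \<nu> i a"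
  shows "is_iso \<Sigma> A B \<mu> \<longleftrightarrow> is_iso \<Sigma> A B \<nu>"
proof -
  have "bij_betw (\<mu> i) (carr A i) (carr B i) \<longleftrightarrow> bij_betw (\<nu> i) (carr A i) (carr B i)"
    if "i \<in> sorts \<Sigma>" for i
    using eq[OF that] by (rule bij_betw_cong)
  moreover have "map2 \<mu> (arg_sorts \<Sigma> \<omega>) xs = map2 \<nu> (arg_sorts \<Sigma> \<omega>) xs"
    if "\<omega> \<in> ops \<Sigma>" "xs \<in> tuples (carr A) (arg_sorts \<Sigma> \<omega>)" for \<omega> xs
    using that assms(1) by (intro map2_cong_tuples[OF that(2)] eq) (auto simp: is_signature_def)
  moreover have "\<mu> (res_sort \<Sigma> \<omega>) (op_interp A \<omega> xs) = \<nu> (res_sort \<Sigma> \<omega>) (op_interp A \<omega> xs)"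
    if "\<omega> \<in> ops \<Sigma>" "xs \<in> tuples (carr A) (arg_sorts \<Sigma> \<omega>)" for \<omega> xs
    using that assms(1,2) by (intro eq) (auto simp: is_signature_def is_algebra_def)
  ultimately show ?thesis
    unfolding is_iso_def by (simp del: map_eq_conv cong: ball_cong)
qed

lemma multi_model_tuples:
  assumes "is_multi_model \<Sigma> (A, \<Phi>, F)" and "f \<in> F" and "\<phi> \<in> syms \<Phi>"
  shows "f \<phi> \<subseteq> tuples (carr A) (rel_type \<Phi> \<phi>)"
  using assms by (fastforce simp: is_multi_model_def interpretations_def)

lemma is_aut_cong:
  assumes M: "is_multi_model \<Sigma> (A, \<Phi>, F)" and f: "f \<in> F"
    and eq: "\<And>i a. i \<in> sorts \<Sigma> \<Longrightarrow> a \<in> carr A i \<Longrightarrow> s i a = t i a"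
  shows "is_aut \<Sigma> (A, \<Phi>, f) s \<longleftrightarrow> is_aut \<Sigma> (A, \<Phi>, f) t"
proof -
  have "bij_betw (s i) (carr A i) (carr A i) \<longleftrightarrow> bij_betw (t i) (carr A i) (carr A i)"
    if "i \<in> sorts \<Sigma>" for i
    using eq[OF that] by (rule bij_betw_cong)
  moreover have "map2 s (rel_type \<Phi> \<phi>) xs = map2 t (rel_type \<Phi> \<phi>) xs"
    if "\<phi> \<in> syms \<Phi>" "xs \<in> f \<phi>" for \<phi> xs
  proof (rule map2_cong_tuples)
    show "xs \<in> tuples (carr A) (rel_type \<Phi> \<phi>)"
      using multi_model_tuples[OF M f] that by blast
    show "s i a = t i a" if "i \<in> set (rel_type \<Phi> \<phi>)" "a \<in> carr A i" for i a
      using that \<open>\<phi> \<in> syms \<Phi>\<close> M by (intro eq) (auto simp: is_multi_model_def)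
  qed
  ultimately show ?thesis
    unfolding is_aut_def by (simp del: map_eq_conv cong: ball_cong)
qed

definition restrict_family ::
  "('s, 'o) signature \<Rightarrow> ('s, 'o, 'a) algebra \<Rightarrow> ('s \<Rightarrow> 'a \<Rightarrow> 'a) \<Rightarrow> 's \<Rightarrow> 'a \<Rightarrow> 'a" where
  "restrict_family \<Sigma> A s = (\<lambda>i\<in>sorts \<Sigma>. restrict (s i) (carr A i))"

text \<open>Restriction picks the extensional representative of a plain family, which links
  membership in \<open>Aut\<close> with \<open>is_aut\<close>.\<close>

lemma restrict_family_in_Aut:
  assumes "is_multi_model \<Sigma> (A, \<Phi>, F)" and "f \<in> F"
  shows "restrict_family \<Sigma> A s \<in> Aut \<Sigma> (A, \<Phi>, f) \<longleftrightarrow> is_aut \<Sigma> (A, \<Phi>, f) s"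
proof -
  have "is_aut \<Sigma> (A, \<Phi>, f) (restrict_family \<Sigma> A s) \<longleftrightarrow> is_aut \<Sigma> (A, \<Phi>, f) s"
    by (rule is_aut_cong[OF assms]) (simp add: restrict_family_def)
  then show ?thesis
    by (simp add: Aut_iff restrict_family_def)
qed

lemma family_eqI:
  assumes "s \<in> (\<Pi>\<^sub>E i\<in>sorts \<Sigma>. extensional (carr A i))" and "t \<in> (\<Pi>\<^sub>E i\<in>sorts \<Sigma>. extensional (carr A i))"
    and "\<And>i a. i \<in> sorts \<Sigma> \<Longrightarrow> a \<in> carr A i \<Longrightarrow> s i a = t i a"
  shows "s = t"
proof (rule PiE_ext[OF assms(1,2)])
  fix i assume i: "i \<in> sorts \<Sigma>"
  show "s i = t i"
    using assms i by (intro extensionalityI[of _ "carr A i"]) auto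
qed

section \<open>Conjugation by an isomorphism\<close>

lemma conjugate_in_PiE:
  "conjugate \<Sigma> A B \<mu> s \<in> (\<Pi>\<^sub>E i\<in>sorts \<Sigma>. extensional (carr B i))"
  by (simp add: conjugate_def)

text \<open>At a point \<open>\<mu> i a\<close> the inverse inside \<open>conjugate\<close> cancels
  by injectivity. Since \<mu> is onto, these points exhaust the carriers of
  \<open>B\<close>.\<close>

lemma conjugate_apply:
  assumes "is_iso \<Sigma> A B \<mu>" and "i \<in> sorts \<Sigma>" and "a \<in> carr A i"
  shows "conjugate \<Sigma> A B \<mu> s i (\<mu> i a) = \<mu> i (s i a)"
  using assms by (auto simp: conjugate_def is_iso_def bij_betw_def)

lemma iso_obtain:
  assumes "is_iso \<Sigma> A B \<mu>" and "i \<in> sorts \<Sigma>" and "b \<in> carr B i"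
  obtains a where "a \<in> carr A i" and "b = \<mu> i a"
proof -
  have "b \<in> \<mu> i ` carr A i"
    using assms by (simp add: is_iso_def bij_betw_def)
  then show ?thesis
    using that by blast
qed

lemma is_aut_closed:
  assumes "is_aut \<Sigma> (A, \<Phi>, f) s" and "i \<in> sorts \<Sigma>" and "a \<in> carr A i"
  shows "s i a \<in> carr A i"
  using assms by (auto simp: is_aut_def bij_betw_def)

text \<open>On the carriers related families determine each other: t is fixed by s because \<mu> is
  onto, and s by t because \<mu> is injective. So equality of the two sets can be tested one related
  pair at a time.\<close>

lemma Aut_conjugate_iff:
  assumes M1: "is_multi_model \<Sigma> (A, \<Phi>\<^sub>1, F\<^sub>1)" "f \<in> F\<^sub>1"
    and M2: "is_multi_model \<Sigma> (B, \<Phi>\<^sub>2, F\<^sub>2)" "g \<in> F\<^sub>2"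
    and iso: "is_iso \<Sigma> A B \<mu>"
  shows "Aut \<Sigma> (B, \<Phi>\<^sub>2, g) = conjugate \<Sigma> A B \<mu> ` Aut \<Sigma> (A, \<Phi>\<^sub>1, f) \<longleftrightarrow>
     (\<forall>s t. conj_related \<Sigma> A \<mu> s t \<longrightarrow> is_aut \<Sigma> (A, \<Phi>\<^sub>1, f) s = is_aut \<Sigma> (B, \<Phi>\<^sub>2, g) t)"
proof
  assume Aut: "Aut \<Sigma> (B, \<Phi>\<^sub>2, g) = conjugate \<Sigma> A B \<mu> ` Aut \<Sigma> (A, \<Phi>\<^sub>1, f)"
  show "\<forall>s t. conj_related \<Sigma> A \<mu> s t \<longrightarrow> is_aut \<Sigma> (A, \<Phi>\<^sub>1, f) s = is_aut \<Sigma> (B, \<Phi>\<^sub>2, g) t"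
  proof (intro allI impI)
    fix s t assume rel: "conj_related \<Sigma> A \<mu> s t"
    \<comment> \<open>Both directions compare a conjugate with t; the relation turns this into a
      comparison with s on the side of \<open>A\<close>.\<close>
    have t: "conjugate \<Sigma> A B \<mu> s' i b = t i b \<longleftrightarrow> \<mu> i (s' i a) = \<mu> i (s i a)"
      if "i \<in> sorts \<Sigma>" "a \<in> carr A i" "b = \<mu> i a" for s' i a b
      using conjugate_apply[OF iso that(1,2)] rel that by (simp add: conj_related_def)
    show "is_aut \<Sigma> (A, \<Phi>\<^sub>1, f) s = is_aut \<Sigma> (B, \<Phi>\<^sub>2, g) t"
    proof
      assume "is_aut \<Sigma> (A, \<Phi>\<^sub>1, f) s"
      then have "restrict_family \<Sigma> A s \<in> Aut \<Sigma> (A, \<Phi>\<^sub>1, f)"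
        using restrict_family_in_Aut[OF M1] by blast
      then have "is_aut \<Sigma> (B, \<Phi>\<^sub>2, g) (conjugate \<Sigma> A B \<mu> (restrict_family \<Sigma> A s))"
        using Aut by (auto simp: Aut_iff)
      moreover have "conjugate \<Sigma> A B \<mu> (restrict_family \<Sigma> A s) i b = t i b"
        if i: "i \<in> sorts \<Sigma>" and b: "b \<in> carr B i" for i b
      proof -
        obtain a where "a \<in> carr A i" "b = \<mu> i a"
          using iso_obtain[OF iso i b] .
        then show ?thesis
          using i by (simp add: t[OF i] restrict_family_def)
      qed
      ultimately show "is_aut \<Sigma> (B, \<Phi>\<^sub>2, g) t"
        using is_aut_cong[OF M2] by blast
    next
      assume "is_aut \<Sigma> (B, \<Phi>\<^sub>2, g) t"
      then have "restrict_family \<Sigma> B t \<in> Aut \<Sigma> (B, \<Phi>\<^sub>2, g)"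
        using restrict_family_in_Aut[OF M2] by blast
      then obtain s' where s': "s' \<in> Aut \<Sigma> (A, \<Phi>\<^sub>1, f)"
        and eq: "restrict_family \<Sigma> B t = conjugate \<Sigma> A B \<mu> s'"
        using Aut by blast
      have aut': "is_aut \<Sigma> (A, \<Phi>\<^sub>1, f) s'"
        using s' by (simp add: Aut_iff)
      have "s' i a = s i a" if i: "i \<in> sorts \<Sigma>" and a: "a \<in> carr A i" for i a
      proof -
        have bij: "bij_betw (\<mu> i) (carr A i) (carr B i)"
          using iso i by (simp add: is_iso_def)
        have "conjugate \<Sigma> A B \<mu> s' i (\<mu> i a) = t i (\<mu> i a)"
          using eq[symmetric] i a bij by (auto simp: restrict_family_def bij_betw_def)
        then have "\<mu> i (s' i a) = \<mu> i (s i a)"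
          using t[OF i a] by simp
        moreover have "s i a \<in> carr A i"
          using rel i a by (simp add: conj_related_def)
        \<comment> \<open>Cancelling \<mu> requires both values in the carrier:
          \<open>s' i a\<close> because \<open>s'\<close> is an automorphism, \<open>s i a\<close>
          by the relation.\<close>
        ultimately show ?thesis
          using bij is_aut_closed[OF aut' i a] by (auto simp: bij_betw_def dest: inj_onD)
      qed
      then show "is_aut \<Sigma> (A, \<Phi>\<^sub>1, f) s"
        using aut' is_aut_cong[OF M1] by blast
    qed
  qed
next
  assume *: "\<forall>s t. conj_related \<Sigma> A \<mu> s t \<longrightarrow> is_aut \<Sigma> (A, \<Phi>\<^sub>1, f) s = is_aut \<Sigma> (B, \<Phi>\<^sub>2, g) t"
  show "Aut \<Sigma> (B, \<Phi>\<^sub>2, g) = conjugate \<Sigma> A B \<mu> ` Aut \<Sigma> (A, \<Phi>\<^sub>1, f)"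
  proof (intro equalityI subsetI)
    fix t assume "t \<in> conjugate \<Sigma> A B \<mu> ` Aut \<Sigma> (A, \<Phi>\<^sub>1, f)"
    then obtain s where s: "is_aut \<Sigma> (A, \<Phi>\<^sub>1, f) s" and t: "t = conjugate \<Sigma> A B \<mu> s"
      by (auto simp: Aut_iff)
    have "conj_related \<Sigma> A \<mu> s t"
      using is_aut_closed[OF s] conjugate_apply[OF iso] by (simp add: conj_related_def t)
    then have "is_aut \<Sigma> (B, \<Phi>\<^sub>2, g) t"
      using * s by blast
    then show "t \<in> Aut \<Sigma> (B, \<Phi>\<^sub>2, g)"
      unfolding Aut_iff t by (rule conjI[OF conjugate_in_PiE])
  next
    fix t assume t: "t \<in> Aut \<Sigma> (B, \<Phi>\<^sub>2, g)"
    then have aut: "is_aut \<Sigma> (B, \<Phi>\<^sub>2, g) t"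
      by (simp add: Aut_iff)
    \<comment> \<open>On the carriers s = \<mu>^-1 t \<mu> is the only candidate related to t. The
      inverse is taken inside the image of \<mu>, since t permutes the carriers of
      \<open>B\<close>.\<close>
    define s where "s i a = inv_into (carr A i) (\<mu> i) (t i (\<mu> i a))" for i a
    have s: "s i a \<in> carr A i \<and> t i (\<mu> i a) = \<mu> i (s i a)"
      if i: "i \<in> sorts \<Sigma>" and a: "a \<in> carr A i" for i a
    proof -
      have \<mu>: "\<mu> i ` carr A i = carr B i"
        using iso i by (simp add: is_iso_def bij_betw_def)
      then have "t i (\<mu> i a) \<in> \<mu> i ` carr A i"
        using is_aut_closed[OF aut i] a by blast
      then show ?thesis
        unfolding s_def by (simp add: inv_into_into f_inv_into_f)
    qed
    then have "conj_related \<Sigma> A \<mu> s t"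
      by (simp add: conj_related_def)
    then have "restrict_family \<Sigma> A s \<in> Aut \<Sigma> (A, \<Phi>\<^sub>1, f)"
      using * aut restrict_family_in_Aut[OF M1] by blast
    moreover have "t = conjugate \<Sigma> A B \<mu> (restrict_family \<Sigma> A s)"
    proof (rule family_eqI[where \<Sigma> = \<Sigma> and A = B])
      show "t \<in> (\<Pi>\<^sub>E i\<in>sorts \<Sigma>. extensional (carr B i))"
        using t by (simp add: Aut_iff)
      show "conjugate \<Sigma> A B \<mu> (restrict_family \<Sigma> A s) \<in> (\<Pi>\<^sub>E i\<in>sorts \<Sigma>. extensional (carr B i))"
        by (rule conjugate_in_PiE)
      fix i b assume i: "i \<in> sorts \<Sigma>" and b: "b \<in> carr B i"
      obtain a where a: "a \<in> carr A i" "b = \<mu> i a"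
        using iso_obtain[OF iso i b] .
      then show "t i b = conjugate \<Sigma> A B \<mu> (restrict_family \<Sigma> A s) i b"
        using conjugate_apply[OF iso i a(1)] s[OF i a(1)] i by (simp add: restrict_family_def)
    qed
    ultimately show "t \<in> conjugate \<Sigma> A B \<mu> ` Aut \<Sigma> (A, \<Phi>\<^sub>1, f)"
      by blast
  qed
qed


section \<open>Equivalence as a bounded formula over the codes of the tables\<close>

text \<open>Membership is spelled \<open>\<exists>b\<in>code_set d. m a = b\<close>, so that only
  equalities and quantifiers over coded lists occur.\<close>

definition bij_code :: "(nat \<Rightarrow> nat) \<Rightarrow> nat \<Rightarrow> nat \<Rightarrow> bool" where
  "bij_code m c d \<longleftrightarrow>
     (\<forall>a\<in>code_set c. \<exists>b\<in>code_set d. m a = b) \<and>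
     (\<forall>a\<in>code_set c. \<forall>a'\<in>code_set c. m a = m a' \<longrightarrow> a = a') \<and>
     (\<forall>b\<in>code_set d. \<exists>a\<in>code_set c. m a = b)"

text \<open>Only the first \<open>code_length is\<close> entries are compared; for tuples of type
  \<open>is\<close> these are all of them.\<close>

definition map_code :: "(nat \<Rightarrow> nat \<Rightarrow> nat) \<Rightarrow> nat \<Rightarrow> nat \<Rightarrow> nat \<Rightarrow> bool" where
  "map_code \<mu> is xs ys \<longleftrightarrow>
     (\<forall>k < code_length is. code_nth ys k = \<mu> (code_nth is k) (code_nth xs k))"

text \<open>\<open>code_fst x\<close> holds the carrier rows and
  \<open>code_fst (code_snd x)\<close> the operation rows, each a nested pair of symbol, argument
  sorts, result sort and graph. The homomorphism condition says that \<mu> carries every line of a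
  graph in \<open>x\<close> to a line of the graph of the same symbol in \<open>y\<close>.\<close>

definition iso_code :: "nat \<Rightarrow> nat \<Rightarrow> (nat \<Rightarrow> nat \<Rightarrow> nat) \<Rightarrow> bool" where
  "iso_code x y \<mu> \<longleftrightarrow>
     (\<forall>r\<in>code_set (code_fst x). \<forall>r'\<in>code_set (code_fst y).
        code_fst r = code_fst r' \<longrightarrow> bij_code (\<mu> (code_fst r)) (code_snd r) (code_snd r')) \<and>
     (\<forall>r\<in>code_set (code_fst (code_snd x)). \<forall>r'\<in>code_set (code_fst (code_snd y)).
        code_fst r = code_fst r' \<longrightarrow>
        (\<forall>e\<in>code_set (code_snd (code_snd (code_snd r))). \<exists>e'\<in>code_set (code_snd (code_snd (code_snd r'))).
           map_code \<mu> (code_fst (code_snd r)) (code_fst e) (code_fst e') \<and>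
           \<mu> (code_fst (code_snd (code_snd r))) (code_snd e) = code_snd e'))"

text \<open>The type of a symbol and its relation stand in different lists, the latter once for each
  interpretation, so the rows are joined by the name of the symbol.\<close>

definition aut_code :: "nat \<Rightarrow> nat \<Rightarrow> (nat \<Rightarrow> nat \<Rightarrow> nat) \<Rightarrow> bool" where
  "aut_code x u s \<longleftrightarrow>
     (\<forall>r\<in>code_set (code_fst x). bij_code (s (code_fst r)) (code_snd r) (code_snd r)) \<and>
     (\<forall>p\<in>code_set (code_fst (code_snd (code_snd x))). \<forall>r\<in>code_set u.
        code_fst p = code_fst r \<longrightarrow>
        (\<forall>xs\<in>code_set (code_snd r). \<exists>ys\<in>code_set (code_snd r). map_code s (code_snd p) xs ys))"

definition conj_code ::
  "nat \<Rightarrow> (nat \<Rightarrow> nat \<Rightarrow> nat) \<Rightarrow> (nat \<Rightarrow> nat \<Rightarrow> nat) \<Rightarrow> (nat \<Rightarrow> nat \<Rightarrow> nat) \<Rightarrow> bool" where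
  "conj_code x \<mu> s t \<longleftrightarrow>
     (\<forall>r\<in>code_set (code_fst x). \<forall>a\<in>code_set (code_snd r).
        (\<exists>b\<in>code_set (code_snd r). s (code_fst r) a = b) \<and>
        t (code_fst r) (\<mu> (code_fst r) a) = \<mu> (code_fst r) (s (code_fst r) a))"

definition equiv_code :: "nat \<Rightarrow> nat \<Rightarrow> nat \<Rightarrow> nat \<Rightarrow> nat \<Rightarrow> bool" where
  "equiv_code N x y u v \<longleftrightarrow>
     (\<exists>c < N ^ (N * N). iso_code x y (digit N c) \<and>
        (\<forall>d < N ^ (N * N). \<forall>e < N ^ (N * N).
           conj_code x (digit N c) (digit N d) (digit N e) \<longrightarrow>
           (aut_code x u (digit N d) \<longleftrightarrow> aut_code y v (digit N e))))"

abbreviation interps_code :: "nat \<Rightarrow> nat" where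
  "interps_code x \<equiv> code_snd (code_snd (code_snd x))"

text \<open>The bijection \<alpha> is stored in row 0 of a digit table, as a map between positions
  in the two lists of interpretations. Positions identify interpretations, whose codes depend on the
  order of their rows.\<close>

definition multi_equiv_code :: "nat \<Rightarrow> nat \<Rightarrow> nat \<Rightarrow> bool" where
  "multi_equiv_code N x y \<longleftrightarrow>
     (\<exists>c < N ^ (N * N).
        (\<forall>k < code_length (interps_code x). digit N c 0 k < code_length (interps_code y) \<and>
           equiv_code N x y (code_nth (interps_code x) k) (code_nth (interps_code y) (digit N c 0 k))) \<and>
        (\<forall>k < code_length (interps_code x). \<forall>l < code_length (interps_code x).
           digit N c 0 k = digit N c 0 l \<longrightarrow> k = l) \<and>
        (\<forall>m < code_length (interps_code y). \<exists>k < code_length (interps_code x). digit N c 0 k = m))"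

text \<open>Families enter through their codes, with base and code functions of the environment, so
  that this applies below the quantifiers over codes.\<close>

lemma decidable_bij_code:
  assumes "computable n N" "computable n c" "computable n i" "computable n f" "computable n g"
  shows "decidable n (\<lambda>xs. bij_code (digit (N xs) (c xs) (i xs)) (f xs) (g xs))"
  unfolding bij_code_def
  using assms by (intro computable_basic computable_codes computable_digit)

lemma decidable_map_code:
  assumes "computable n N" "computable n c" "computable n i" "computable n f" "computable n g"
  shows "decidable n (\<lambda>xs. map_code (digit (N xs) (c xs)) (i xs) (f xs) (g xs))"
  unfolding map_code_def
  using assms by (intro computable_basic computable_codes computable_digit)

lemma decidable_iso_code:
  assumes "computable n N" "computable n c" "computable n f" "computable n g"
  shows "decidable n (\<lambda>xs. iso_code (f xs) (g xs) (digit (N xs) (c xs)))"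
  unfolding iso_code_def
  using assms
  by (intro computable_basic computable_codes computable_digit decidable_bij_code decidable_map_code)

lemma decidable_aut_code:
  assumes "computable n N" "computable n c" "computable n f" "computable n g"
  shows "decidable n (\<lambda>xs. aut_code (f xs) (g xs) (digit (N xs) (c xs)))"
  unfolding aut_code_def
  using assms
  by (intro computable_basic computable_codes computable_digit decidable_bij_code decidable_map_code)

lemma decidable_conj_code:
  assumes "computable n N" "computable n c" "computable n d" "computable n e" "computable n f"
  shows "decidable n (\<lambda>xs. conj_code (f xs) (digit (N xs) (c xs)) (digit (N xs) (d xs)) (digit (N xs) (e xs)))"
  unfolding conj_code_def
  using assms by (intro computable_basic computable_codes computable_digit)

lemma decidable_equiv_code:
  assumes "computable n N" "computable n f" "computable n g" "computable n u" "computable n v"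
  shows "decidable n (\<lambda>xs. equiv_code (N xs) (f xs) (g xs) (u xs) (v xs))"
  unfolding equiv_code_def
  using assms
  by (intro computable_basic decidable_iso_code decidable_aut_code decidable_conj_code)

lemma decidable_multi_equiv_code:
  assumes "computable n N" "computable n f" "computable n g"
  shows "decidable n (\<lambda>xs. multi_equiv_code (N xs) (f xs) (g xs))"
  unfolding multi_equiv_code_def
  using assms
  by (intro computable_basic computable_codes computable_digit decidable_equiv_code)


section \<open>Correctness of the formula\<close>

text \<open>Lists whose order is arbitrary are replaced by their sets; sequences whose order matters
  stay codes.\<close>

definition codes_structure ::
  "(nat, nat) signature \<Rightarrow> (nat, nat, nat) algebra \<Rightarrow> (nat, nat) rel_signature \<Rightarrow> nat \<Rightarrow> bool" where
  "codes_structure \<Sigma> A \<Phi> x \<longleftrightarrow>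
     (\<lambda>r. (code_fst r, code_set (code_snd r))) ` code_set (code_fst x) =
       (\<lambda>i. (i, carr A i)) ` sorts \<Sigma> \<and>
     (\<lambda>r. (code_fst r, code_fst (code_snd r), code_fst (code_snd (code_snd r)),
           code_set (code_snd (code_snd (code_snd r))))) ` code_set (code_fst (code_snd x)) =
       (\<lambda>\<omega>. (\<omega>, list_encode (arg_sorts \<Sigma> \<omega>), res_sort \<Sigma> \<omega>,
           (\<lambda>xs. prod_encode (list_encode xs, op_interp A \<omega> xs)) ` tuples (carr A) (arg_sorts \<Sigma> \<omega>))) ` ops \<Sigma> \<and>
     (\<lambda>p. (code_fst p, code_snd p)) ` code_set (code_fst (code_snd (code_snd x))) =
       (\<lambda>\<phi>. (\<phi>, list_encode (rel_type \<Phi> \<phi>))) ` syms \<Phi>"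

definition codes_interp :: "(nat, nat) rel_signature \<Rightarrow> (nat, nat) rel_interp \<Rightarrow> nat \<Rightarrow> bool" where
  "codes_interp \<Phi> f u \<longleftrightarrow>
     (\<lambda>r. (code_fst r, code_set (code_snd r))) ` code_set u = (\<lambda>\<phi>. (\<phi>, list_encode ` f \<phi>)) ` syms \<Phi>"

text \<open>Decoded rows and named objects have the same image, so a quantifier over rows becomes
  one over sorts or symbols, whatever the order of the rows.\<close>

lemma Ball_image_eq:
  assumes "g ` S = h ` T"
  shows "(\<forall>r\<in>S. P (g r)) \<longleftrightarrow> (\<forall>i\<in>T. P (h i))"
  using assms by (metis (mono_tags, lifting) image_iff)

lemma Ball_carriers:
  assumes "codes_structure \<Sigma> A \<Phi> x"
  shows "(\<forall>r\<in>code_set (code_fst x). P (code_fst r) (code_set (code_snd r))) \<longleftrightarrow>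
     (\<forall>i\<in>sorts \<Sigma>. P i (carr A i))"
proof -
  have "(\<lambda>r. (code_fst r, code_set (code_snd r))) ` code_set (code_fst x) =
      (\<lambda>i. (i, carr A i)) ` sorts \<Sigma>"
    using assms by (simp add: codes_structure_def)
  from Ball_image_eq[OF this, of "\<lambda>(i, C). P i C"] show ?thesis by simp
qed

lemma Ball_operations:
  assumes "codes_structure \<Sigma> A \<Phi> x"
  shows "(\<forall>r\<in>code_set (code_fst (code_snd x)). P (code_fst r) (code_fst (code_snd r))
       (code_fst (code_snd (code_snd r))) (code_set (code_snd (code_snd (code_snd r))))) \<longleftrightarrow>
     (\<forall>\<omega>\<in>ops \<Sigma>. P \<omega> (list_encode (arg_sorts \<Sigma> \<omega>)) (res_sort \<Sigma> \<omega>)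
       ((\<lambda>xs. prod_encode (list_encode xs, op_interp A \<omega> xs)) ` tuples (carr A) (arg_sorts \<Sigma> \<omega>)))"
proof -
  have "(\<lambda>r. (code_fst r, code_fst (code_snd r), code_fst (code_snd (code_snd r)),
           code_set (code_snd (code_snd (code_snd r))))) ` code_set (code_fst (code_snd x)) =
       (\<lambda>\<omega>. (\<omega>, list_encode (arg_sorts \<Sigma> \<omega>), res_sort \<Sigma> \<omega>,
           (\<lambda>xs. prod_encode (list_encode xs, op_interp A \<omega> xs)) ` tuples (carr A) (arg_sorts \<Sigma> \<omega>))) ` ops \<Sigma>"
    using assms by (simp add: codes_structure_def)
  from Ball_image_eq[OF this, of "\<lambda>(\<omega>, is, j, t). P \<omega> is j t"] show ?thesis by simp
qed

lemma Ball_symbols: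
  assumes "codes_structure \<Sigma> A \<Phi> x"
  shows "(\<forall>p\<in>code_set (code_fst (code_snd (code_snd x))). P (code_fst p) (code_snd p)) \<longleftrightarrow>
     (\<forall>\<phi>\<in>syms \<Phi>. P \<phi> (list_encode (rel_type \<Phi> \<phi>)))"
proof -
  have "(\<lambda>p. (code_fst p, code_snd p)) ` code_set (code_fst (code_snd (code_snd x))) =
       (\<lambda>\<phi>. (\<phi>, list_encode (rel_type \<Phi> \<phi>))) ` syms \<Phi>"
    using assms by (simp only: codes_structure_def)
  from Ball_image_eq[OF this, of "\<lambda>(\<phi>, is). P \<phi> is"] show ?thesis
    by (simp only: prod.case)
qed

lemma Ball_relations:
  assumes "codes_interp \<Phi> f u"
  shows "(\<forall>r\<in>code_set u. P (code_fst r) (code_set (code_snd r))) \<longleftrightarrow>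
     (\<forall>\<phi>\<in>syms \<Phi>. P \<phi> (list_encode ` f \<phi>))"
  using Ball_image_eq[OF assms[unfolded codes_interp_def], of "\<lambda>(\<phi>, R). P \<phi> R"] by simp

lemma image_eq_iff: "m ` C = D \<longleftrightarrow> (\<forall>a\<in>C. m a \<in> D) \<and> (\<forall>b\<in>D. \<exists>a\<in>C. m a = b)"
proof
  assume *: "(\<forall>a\<in>C. m a \<in> D) \<and> (\<forall>b\<in>D. \<exists>a\<in>C. m a = b)"
  then have "m ` C \<subseteq> D" by blast
  moreover have "D \<subseteq> m ` C" using * by fastforce
  ultimately show "m ` C = D" by blast
qed blast

lemma bij_code_iff: "bij_code m c d \<longleftrightarrow> bij_betw m (code_set c) (code_set d)"
  unfolding bij_code_def bij_betw_def inj_on_def image_eq_iff by auto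

lemma map_code_iff:
  assumes "length xs = length is" and "length ys = length is"
  shows "map_code \<mu> (list_encode is) (list_encode xs) (list_encode ys) \<longleftrightarrow> ys = map2 \<mu> is xs"
proof -
  have "map_code \<mu> (list_encode is) (list_encode xs) (list_encode ys) \<longleftrightarrow>
      (\<forall>k < length is. ys ! k = \<mu> (is ! k) (xs ! k))"
    using assms by (simp add: map_code_def code_nth_list_encode)
  also have "\<dots> \<longleftrightarrow> ys = map2 \<mu> is xs"
    using assms by (auto simp: list_eq_iff_nth_eq)
  finally show ?thesis .
qed

lemma map2_in_tuples:
  assumes "\<And>i a. i \<in> set is \<Longrightarrow> a \<in> D i \<Longrightarrow> \<mu> i a \<in> E i" and "xs \<in> tuples D is"
  shows "map2 \<mu> is xs \<in> tuples E is"
  using assms by (auto simp: in_tuples_iff)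

lemma iso_code_iff:
  assumes \<Sigma>: "is_signature \<Sigma>" and x: "codes_structure \<Sigma> A \<Phi>\<^sub>1 x" and y: "codes_structure \<Sigma> B \<Phi>\<^sub>2 y"
  shows "iso_code x y \<mu> \<longleftrightarrow> is_iso \<Sigma> A B \<mu>"
proof -
  \<comment> \<open>Once both quantifiers over rows have become quantifiers over sorts, the guard on
    names leaves a single sort.\<close>
  have carriers: "(\<forall>r\<in>code_set (code_fst x). \<forall>r'\<in>code_set (code_fst y). code_fst r = code_fst r' \<longrightarrow>
        bij_code (\<mu> (code_fst r)) (code_snd r) (code_snd r')) \<longleftrightarrow>
      (\<forall>i\<in>sorts \<Sigma>. bij_betw (\<mu> i) (carr A i) (carr B i))"
    unfolding bij_code_iff
    by (subst Ball_carriers[OF x, of "\<lambda>i C. \<forall>r'\<in>code_set (code_fst y). i = code_fst r' \<longrightarrow>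
          bij_betw (\<mu> i) C (code_set (code_snd r'))"],
        subst Ball_carriers[OF y, of "\<lambda>i' D. i = i' \<longrightarrow> bij_betw (\<mu> i) (carr A i) D" for i]) auto
  let ?args = "\<lambda>\<omega>. list_encode (arg_sorts \<Sigma> \<omega>)"
  let ?op = "\<lambda>A \<omega>. (\<lambda>xs. prod_encode (list_encode xs, op_interp A \<omega> xs)) `
      tuples (carr A) (arg_sorts \<Sigma> \<omega>)"
  let ?hom = "\<lambda>is j t t'. \<forall>e\<in>t. \<exists>e'\<in>t'.
      map_code \<mu> is (code_fst e) (code_fst e') \<and> \<mu> j (code_snd e) = code_snd e'"
  have "(\<forall>r\<in>code_set (code_fst (code_snd x)). \<forall>r'\<in>code_set (code_fst (code_snd y)).
        code_fst r = code_fst r' \<longrightarrow>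
        ?hom (code_fst (code_snd r)) (code_fst (code_snd (code_snd r)))
          (code_set (code_snd (code_snd (code_snd r)))) (code_set (code_snd (code_snd (code_snd r'))))) \<longleftrightarrow>
      (\<forall>\<omega>\<in>ops \<Sigma>. ?hom (?args \<omega>) (res_sort \<Sigma> \<omega>) (?op A \<omega>) (?op B \<omega>))"
    by (subst Ball_operations[OF x, of "\<lambda>\<omega> is j t. \<forall>r'\<in>code_set (code_fst (code_snd y)).
          \<omega> = code_fst r' \<longrightarrow> ?hom is j t (code_set (code_snd (code_snd (code_snd r'))))"],
        subst Ball_operations[OF y, of "\<lambda>\<omega>' is' j' t'. \<omega> = \<omega>' \<longrightarrow>
          ?hom (?args \<omega>) (res_sort \<Sigma> \<omega>) (?op A \<omega>) t'" for \<omega>]) auto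
  \<comment> \<open>The bijections are assumed here: they put the image of \<open>xs\<close> among
    the argument tuples of \<open>B\<close>, so that the graph has a line for it.\<close>
  moreover have "?hom (?args \<omega>) (res_sort \<Sigma> \<omega>) (?op A \<omega>) (?op B \<omega>) \<longleftrightarrow>
      (\<forall>xs\<in>tuples (carr A) (arg_sorts \<Sigma> \<omega>).
        \<mu> (res_sort \<Sigma> \<omega>) (op_interp A \<omega> xs) = op_interp B \<omega> (map2 \<mu> (arg_sorts \<Sigma> \<omega>) xs))"
    if \<omega>: "\<omega> \<in> ops \<Sigma>" and bij: "\<forall>i\<in>sorts \<Sigma>. bij_betw (\<mu> i) (carr A i) (carr B i)" for \<omega>
  proof -
    have "(\<exists>ys\<in>tuples (carr B) (arg_sorts \<Sigma> \<omega>).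
          map_code \<mu> (?args \<omega>) (list_encode xs) (list_encode ys) \<and>
          \<mu> (res_sort \<Sigma> \<omega>) (op_interp A \<omega> xs) = op_interp B \<omega> ys) \<longleftrightarrow>
        \<mu> (res_sort \<Sigma> \<omega>) (op_interp A \<omega> xs) = op_interp B \<omega> (map2 \<mu> (arg_sorts \<Sigma> \<omega>) xs)"
      if xs: "xs \<in> tuples (carr A) (arg_sorts \<Sigma> \<omega>)" for xs
    proof -
      have "map_code \<mu> (?args \<omega>) (list_encode xs) (list_encode ys) \<longleftrightarrow> ys = map2 \<mu> (arg_sorts \<Sigma> \<omega>) xs"
        if "ys \<in> tuples (carr B) (arg_sorts \<Sigma> \<omega>)" for ys
        using xs that by (intro map_code_iff) (auto simp: in_tuples_iff)
      moreover have "map2 \<mu> (arg_sorts \<Sigma> \<omega>) xs \<in> tuples (carr B) (arg_sorts \<Sigma> \<omega>)"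
      proof (rule map2_in_tuples[OF _ xs])
        fix i a assume i: "i \<in> set (arg_sorts \<Sigma> \<omega>)" and a: "a \<in> carr A i"
        have "i \<in> sorts \<Sigma>"
          using \<Sigma> \<omega> i by (auto simp: is_signature_def)
        then show "\<mu> i a \<in> carr B i"
          using bij a by (auto dest: bij_betwE)
      qed
      ultimately show ?thesis by blast
    qed
    then show ?thesis by simp
  qed
  ultimately show ?thesis
    unfolding iso_code_def is_iso_def carriers by (intro conj_cong[OF refl]) simp
qed

lemma aut_code_iff:
  assumes \<Sigma>: "is_signature \<Sigma>" and x: "codes_structure \<Sigma> A \<Phi> x"
    and M: "is_multi_model \<Sigma> (A, \<Phi>, F)" "f \<in> F" and u: "codes_interp \<Phi> f u"
  shows "aut_code x u s \<longleftrightarrow> is_aut \<Sigma> (A, \<Phi>, f) s"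
proof -
  have carriers: "(\<forall>r\<in>code_set (code_fst x). bij_code (s (code_fst r)) (code_snd r) (code_snd r)) \<longleftrightarrow>
      (\<forall>i\<in>sorts \<Sigma>. bij_betw (s i) (carr A i) (carr A i))"
    unfolding bij_code_iff by (rule Ball_carriers[OF x])
  let ?pres = "\<lambda>is R. \<forall>xs\<in>R. \<exists>ys\<in>R. map_code s is xs ys"
  have "(\<forall>p\<in>code_set (code_fst (code_snd (code_snd x))). \<forall>r\<in>code_set u.
        code_fst p = code_fst r \<longrightarrow> ?pres (code_snd p) (code_set (code_snd r))) \<longleftrightarrow>
      (\<forall>\<phi>\<in>syms \<Phi>. ?pres (list_encode (rel_type \<Phi> \<phi>)) (list_encode ` f \<phi>))"
    by (subst Ball_symbols[OF x, of "\<lambda>\<phi> is. \<forall>r\<in>code_set u.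
          \<phi> = code_fst r \<longrightarrow> ?pres is (code_set (code_snd r))"],
        subst Ball_relations[OF u, of "\<lambda>\<psi> R. \<phi> = \<psi> \<longrightarrow>
          ?pres (list_encode (rel_type \<Phi> \<phi>)) R" for \<phi>]) auto
  moreover have "?pres (list_encode (rel_type \<Phi> \<phi>)) (list_encode ` f \<phi>) \<longleftrightarrow>
      (\<forall>xs\<in>f \<phi>. map2 s (rel_type \<Phi> \<phi>) xs \<in> f \<phi>)" if \<phi>: "\<phi> \<in> syms \<Phi>" for \<phi>
  proof -
    \<comment> \<open>Members of \<open>f \<phi>\<close> have the length of the type, so
      \<open>map_code\<close> is equality with the image tuple, and existence of such a member is
      membership of the image.\<close>
    have "map_code s (list_encode (rel_type \<Phi> \<phi>)) (list_encode xs) (list_encode ys) \<longleftrightarrow>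
        ys = map2 s (rel_type \<Phi> \<phi>) xs" if "xs \<in> f \<phi>" "ys \<in> f \<phi>" for xs ys
      using multi_model_tuples[OF M \<phi>] that by (intro map_code_iff) (auto simp: in_tuples_iff)
    then have "(\<exists>ys\<in>f \<phi>. map_code s (list_encode (rel_type \<Phi> \<phi>)) (list_encode xs) (list_encode ys)) \<longleftrightarrow>
        map2 s (rel_type \<Phi> \<phi>) xs \<in> f \<phi>" if "xs \<in> f \<phi>" for xs
      using that by blast
    then show ?thesis by simp
  qed
  ultimately show ?thesis
    unfolding aut_code_def is_aut_def carriers by simp
qed

lemma conj_code_iff:
  assumes "codes_structure \<Sigma> A \<Phi> x"
  shows "conj_code x \<mu> s t \<longleftrightarrow> conj_related \<Sigma> A \<mu> s t"
  unfolding conj_code_def conj_related_def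
  by (subst Ball_carriers[OF assms, of "\<lambda>i C. \<forall>a\<in>C. (\<exists>b\<in>C. s i a = b) \<and> t i (\<mu> i a) = \<mu> i (s i a)"]) auto

text \<open>Neither unpairing nor passing to an entry of a list increases a code.\<close>

lemma codes_structure_less:
  assumes "codes_structure \<Sigma> A \<Phi> x"
  shows "\<forall>i\<in>sorts \<Sigma>. i < Suc x \<and> (\<forall>a\<in>carr A i. a < Suc x)"
proof -
  have "\<forall>r\<in>code_set (code_fst x). code_fst r < Suc x \<and> (\<forall>a\<in>code_set (code_snd r). a < Suc x)"
  proof (intro ballI conjI)
    fix r assume "r \<in> code_set (code_fst x)"
    then have r: "r \<le> x"
      using code_set_less[of r] code_fst_le[of x] by fastforce
    then show "code_fst r < Suc x"
      using code_fst_le[of r] by simp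
    show "a < Suc x" if "a \<in> code_set (code_snd r)" for a
      using code_set_less[OF that] code_snd_le[of r] r by simp
  qed
  then show ?thesis
    by (subst (asm) Ball_carriers[OF assms, of "\<lambda>i C. i < Suc x \<and> (\<forall>a\<in>C. a < Suc x)"])
qed

lemma digit_family_exists:
  assumes "\<forall>i\<in>sorts \<Sigma>. i < N \<and> (\<forall>a\<in>carr A i. a < N)"
    and "\<And>i a. i \<in> sorts \<Sigma> \<Longrightarrow> a \<in> carr A i \<Longrightarrow> s i a < N" and "0 < N"
  obtains c where "c < N ^ (N * N)"
    and "\<And>i a. i \<in> sorts \<Sigma> \<Longrightarrow> a \<in> carr A i \<Longrightarrow> digit N c i a = s i a"
  using digit_exists[OF assms(3), of s] assms(1,2) by metis

text \<open>The third premise compares t and t' only where \<open>conj_related\<close> evaluates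
  them, so either t or \<mu> can be exchanged on its own.\<close>

lemma conj_related_cong:
  assumes "\<And>i a. i \<in> sorts \<Sigma> \<Longrightarrow> a \<in> carr A i \<Longrightarrow> \<mu> i a = \<mu>' i a"
    and "\<And>i a. i \<in> sorts \<Sigma> \<Longrightarrow> a \<in> carr A i \<Longrightarrow> s i a = s' i a"
    and "\<And>i a. i \<in> sorts \<Sigma> \<Longrightarrow> a \<in> carr A i \<Longrightarrow> t i (\<mu> i a) = t' i (\<mu>' i a)"
    and "conj_related \<Sigma> A \<mu> s t"
  shows "conj_related \<Sigma> A \<mu>' s' t'"
  using assms unfolding conj_related_def by metis

text \<open>Bounded quantifiers suffice: the families concerned have their values on the carriers
  below N, hence agree there with families of digits, and the congruence lemmas transport the
  conditions.\<close>

lemma equiv_code_iff: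
  assumes \<Sigma>: "is_signature \<Sigma>"
    and M1: "is_multi_model \<Sigma> (A, \<Phi>\<^sub>1, F\<^sub>1)" "f \<in> F\<^sub>1"
    and M2: "is_multi_model \<Sigma> (B, \<Phi>\<^sub>2, F\<^sub>2)" "g \<in> F\<^sub>2"
    and x: "codes_structure \<Sigma> A \<Phi>\<^sub>1 x" and y: "codes_structure \<Sigma> B \<Phi>\<^sub>2 y"
    and u: "codes_interp \<Phi>\<^sub>1 f u" and v: "codes_interp \<Phi>\<^sub>2 g v"
    and N: "x < N" "y < N"
  shows "equiv_code N x y u v \<longleftrightarrow> aut_equiv \<Sigma> (A, \<Phi>\<^sub>1, f) (B, \<Phi>\<^sub>2, g)"
proof -
  note code_iffs = iso_code_iff[OF \<Sigma> x y] aut_code_iff[OF \<Sigma> x M1 u] aut_code_iff[OF \<Sigma> y M2 v]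
    conj_code_iff[OF x]
  have A: "\<forall>i\<in>sorts \<Sigma>. i < N \<and> (\<forall>a\<in>carr A i. a < N)"
    using codes_structure_less[OF x] N by fastforce
  have B: "\<forall>i\<in>sorts \<Sigma>. i < N \<and> (\<forall>b\<in>carr B i. b < N)"
    using codes_structure_less[OF y] N by fastforce
  have alg: "is_algebra \<Sigma> A"
    using M1 by (simp add: is_multi_model_def)
  let ?rel = "\<lambda>\<mu> s t. conj_related \<Sigma> A \<mu> s t \<longrightarrow> is_aut \<Sigma> (A, \<Phi>\<^sub>1, f) s = is_aut \<Sigma> (B, \<Phi>\<^sub>2, g) t"
  have equiv: "aut_equiv \<Sigma> (A, \<Phi>\<^sub>1, f) (B, \<Phi>\<^sub>2, g) \<longleftrightarrow> (\<exists>\<mu>. is_iso \<Sigma> A B \<mu> \<and> (\<forall>s t. ?rel \<mu> s t))"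
    unfolding aut_equiv_def prod.case
    by (intro ex_cong1 conj_cong[OF refl] Aut_conjugate_iff[OF M1 M2])
  show ?thesis
    unfolding equiv equiv_code_def code_iffs
  proof
    assume "\<exists>c < N ^ (N * N). is_iso \<Sigma> A B (digit N c) \<and>
      (\<forall>d < N ^ (N * N). \<forall>e < N ^ (N * N). ?rel (digit N c) (digit N d) (digit N e))"
    then obtain c where iso: "is_iso \<Sigma> A B (digit N c)"
      and rel: "\<And>d e. d < N ^ (N * N) \<Longrightarrow> e < N ^ (N * N) \<Longrightarrow> ?rel (digit N c) (digit N d) (digit N e)"
      by blast
    have c: "digit N c i a \<in> carr B i" if "i \<in> sorts \<Sigma>" "a \<in> carr A i" for i a
      using iso that by (auto simp: is_iso_def bij_betw_def)
    have "?rel (digit N c) s t" for s t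
    proof
      assume st: "conj_related \<Sigma> A (digit N c) s t"
      have s: "s i a \<in> carr A i" if "i \<in> sorts \<Sigma>" "a \<in> carr A i" for i a
        using st that by (simp add: conj_related_def)
      \<comment> \<open>The relation bounds t as well: each b is some \<mu> a, and t (\<mu> a) =
        \<mu> (s a) lies in the carrier of \<open>B\<close>.\<close>
      have t: "t i b \<in> carr B i" if i: "i \<in> sorts \<Sigma>" and b: "b \<in> carr B i" for i b
      proof -
        obtain a where "a \<in> carr A i" "b = digit N c i a"
          using iso_obtain[OF iso i b] .
        then show ?thesis
          using st i c s by (simp add: conj_related_def)
      qed
      obtain d where d: "d < N ^ (N * N)"
        "\<And>i a. i \<in> sorts \<Sigma> \<Longrightarrow> a \<in> carr A i \<Longrightarrow> digit N d i a = s i a"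
        using digit_family_exists[OF A, of s] A s N by (metis not_less_zero neq0_conv)
      obtain e where e: "e < N ^ (N * N)"
        "\<And>i b. i \<in> sorts \<Sigma> \<Longrightarrow> b \<in> carr B i \<Longrightarrow> digit N e i b = t i b"
        using digit_family_exists[OF B, of t] B t N by (metis not_less_zero neq0_conv)
      have "conj_related \<Sigma> A (digit N c) (digit N d) (digit N e)"
        using c d(2) e(2) by (intro conj_related_cong[OF _ _ _ st]) auto
      then have "is_aut \<Sigma> (A, \<Phi>\<^sub>1, f) (digit N d) = is_aut \<Sigma> (B, \<Phi>\<^sub>2, g) (digit N e)"
        using rel[OF d(1) e(1)] by blast
      then show "is_aut \<Sigma> (A, \<Phi>\<^sub>1, f) s = is_aut \<Sigma> (B, \<Phi>\<^sub>2, g) t"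
        using is_aut_cong[OF M1, of "digit N d" s] is_aut_cong[OF M2, of "digit N e" t] d(2) e(2) by blast
    qed
    then show "\<exists>\<mu>. is_iso \<Sigma> A B \<mu> \<and> (\<forall>s t. ?rel \<mu> s t)"
      using iso by blast
  next
    assume "\<exists>\<mu>. is_iso \<Sigma> A B \<mu> \<and> (\<forall>s t. ?rel \<mu> s t)"
    then obtain \<mu> where iso: "is_iso \<Sigma> A B \<mu>" and rel: "\<And>s t. ?rel \<mu> s t"
      by blast
    have "\<mu> i a \<in> carr B i" if "i \<in> sorts \<Sigma>" "a \<in> carr A i" for i a
      using iso that by (auto simp: is_iso_def bij_betw_def)
    then obtain c where c: "c < N ^ (N * N)"
      "\<And>i a. i \<in> sorts \<Sigma> \<Longrightarrow> a \<in> carr A i \<Longrightarrow> digit N c i a = \<mu> i a"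
      using digit_family_exists[OF A, of \<mu>] B N by (metis not_less_zero neq0_conv)
    \<comment> \<open>Exchanging \<open>digit N c\<close> for \<mu> leaves s and t untouched, so the
      property of \<mu> passes to all s and t, in particular to families of digits.\<close>
    have "?rel (digit N c) s t" for s t
    proof
      assume "conj_related \<Sigma> A (digit N c) s t"
      then have "conj_related \<Sigma> A \<mu> s t"
        by (rule conj_related_cong[rotated 3]) (auto simp: c(2))
      then show "is_aut \<Sigma> (A, \<Phi>\<^sub>1, f) s = is_aut \<Sigma> (B, \<Phi>\<^sub>2, g) t"
        using rel by blast
    qed
    moreover have "is_iso \<Sigma> A B (digit N c)"
      using is_iso_cong[OF \<Sigma> alg, of "digit N c" \<mu> B] c(2) iso by blast
    ultimately show "\<exists>c < N ^ (N * N). is_iso \<Sigma> A B (digit N c) \<and>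
      (\<forall>d < N ^ (N * N). \<forall>e < N ^ (N * N). ?rel (digit N c) (digit N d) (digit N e))"
      using c(1) by blast
  qed
qed

text \<open>The bijections correspond by \<beta> = q^-1 \<alpha> p and \<alpha> = q \<beta> p^-1.
  Sets of interpretations are thereby exchanged for initial segments of positions.\<close>

lemma ex_bij_betw_reindex:
  assumes p: "bij_betw p I F" and q: "bij_betw q J G"
  shows "(\<exists>\<alpha>. bij_betw \<alpha> F G \<and> (\<forall>f\<in>F. R f (\<alpha> f))) \<longleftrightarrow>
     (\<exists>\<beta>. bij_betw \<beta> I J \<and> (\<forall>k\<in>I. R (p k) (q (\<beta> k))))"
proof
  assume "\<exists>\<alpha>. bij_betw \<alpha> F G \<and> (\<forall>f\<in>F. R f (\<alpha> f))"
  then obtain \<alpha> where \<alpha>: "bij_betw \<alpha> F G" "\<And>f. f \<in> F \<Longrightarrow> R f (\<alpha> f)" by blast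
  have "bij_betw (inv_into J q \<circ> (\<alpha> \<circ> p)) I J"
    using bij_betw_trans[OF bij_betw_trans[OF p \<alpha>(1)] bij_betw_inv_into[OF q]] .
  moreover have "R (p k) (q ((inv_into J q \<circ> (\<alpha> \<circ> p)) k))" if "k \<in> I" for k
  proof -
    have "p k \<in> F" using bij_betwE[OF p] that by blast
    then have "\<alpha> (p k) \<in> G" using bij_betwE[OF \<alpha>(1)] by blast
    then show ?thesis using \<alpha>(2)[OF \<open>p k \<in> F\<close>] bij_betw_inv_into_right[OF q] by simp
  qed
  ultimately show "\<exists>\<beta>. bij_betw \<beta> I J \<and> (\<forall>k\<in>I. R (p k) (q (\<beta> k)))" by blast
next
  assume "\<exists>\<beta>. bij_betw \<beta> I J \<and> (\<forall>k\<in>I. R (p k) (q (\<beta> k)))"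
  then obtain \<beta> where \<beta>: "bij_betw \<beta> I J" "\<And>k. k \<in> I \<Longrightarrow> R (p k) (q (\<beta> k))" by blast
  have "bij_betw (q \<circ> (\<beta> \<circ> inv_into I p)) F G"
    using bij_betw_trans[OF bij_betw_trans[OF bij_betw_inv_into[OF p] \<beta>(1)] q] .
  moreover have "R f ((q \<circ> (\<beta> \<circ> inv_into I p)) f)" if "f \<in> F" for f
  proof -
    have "inv_into I p f \<in> I" using bij_betwE[OF bij_betw_inv_into[OF p]] that by blast
    from \<beta>(2)[OF this] show ?thesis using bij_betw_inv_into_right[OF p that] by simp
  qed
  ultimately show "\<exists>\<alpha>. bij_betw \<alpha> F G \<and> (\<forall>f\<in>F. R f (\<alpha> f))" by blast
qed

section \<open>Interpretations addressed by position\<close>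

definition codes_multi_model ::
  "(nat, nat) signature \<Rightarrow> (nat, nat, nat, nat) multi_model \<Rightarrow> nat \<Rightarrow> bool" where
  "codes_multi_model \<Sigma> = (\<lambda>(A, \<Phi>, F) x. codes_structure \<Sigma> A \<Phi> x \<and>
     lists_set (codes_interp \<Phi>) F (list_decode (interps_code x)))"

lemma length_le_list_encode: "length xs \<le> list_encode xs"
proof (induction xs)
  case (Cons x xs)
  then show ?case
    using le_prod_encode_2[of "list_encode xs" x] by simp
qed simp

text \<open>Positions of interpretations serve as columns and as digits, so they have to be below
  N.\<close>

lemma code_length_interps_le: "code_length (interps_code x) \<le> x"
proof -
  have "code_length (interps_code x) \<le> interps_code x"
    using length_le_list_encode[of "list_decode (interps_code x)"] by simp
  also have "\<dots> \<le> x"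
    by (meson code_snd_le order.trans)
  finally show ?thesis .
qed

lemma bij_betw_lessThan_iff:
  "bij_betw \<beta> {..<n} {..<m} \<longleftrightarrow>
     (\<forall>k < n. \<beta> k < m) \<and> (\<forall>k < n. \<forall>l < n. \<beta> k = \<beta> l \<longrightarrow> k = l) \<and> (\<forall>j < (m::nat). \<exists>k < (n::nat). \<beta> k = j)"
  unfolding bij_betw_def inj_on_def image_eq_iff by auto

lemma multi_equiv_code_iff:
  assumes \<Sigma>: "is_signature \<Sigma>"
    and M1: "is_multi_model \<Sigma> (A, \<Phi>\<^sub>1, F\<^sub>1)" and M2: "is_multi_model \<Sigma> (B, \<Phi>\<^sub>2, F\<^sub>2)"
    and x: "codes_multi_model \<Sigma> (A, \<Phi>\<^sub>1, F\<^sub>1) x" and y: "codes_multi_model \<Sigma> (B, \<Phi>\<^sub>2, F\<^sub>2) y"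
    and N: "x < N" "y < N"
  shows "multi_equiv_code N x y \<longleftrightarrow> multi_aut_equiv \<Sigma> (A, \<Phi>\<^sub>1, F\<^sub>1) (B, \<Phi>\<^sub>2, F\<^sub>2)"
proof -
  let ?u = "interps_code x" and ?v = "interps_code y"
  let ?n = "code_length ?u" and ?m = "code_length ?v"
  have x': "codes_structure \<Sigma> A \<Phi>\<^sub>1 x" and y': "codes_structure \<Sigma> B \<Phi>\<^sub>2 y"
    using x y by (simp_all add: codes_multi_model_def)
  obtain fs where fs: "distinct fs" "set fs = F\<^sub>1" "list_all2 (codes_interp \<Phi>\<^sub>1) fs (list_decode ?u)"
    using x by (auto simp: codes_multi_model_def lists_set_def)
  obtain gs where gs: "distinct gs" "set gs = F\<^sub>2" "list_all2 (codes_interp \<Phi>\<^sub>2) gs (list_decode ?v)"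
    using y by (auto simp: codes_multi_model_def lists_set_def)
  have lengths: "length fs = ?n" "length gs = ?m"
    using fs(3) gs(3) by (auto dest: list_all2_lengthD)
  let ?R = "\<lambda>f g. aut_equiv \<Sigma> (A, \<Phi>\<^sub>1, f) (B, \<Phi>\<^sub>2, g)"
  \<comment> \<open>The enumerations are free of repetitions, which makes indexing a
    bijection.\<close>
  have "bij_betw ((!) fs) {..<?n} F\<^sub>1" "bij_betw ((!) gs) {..<?m} F\<^sub>2"
    using fs gs lengths by (auto intro: bij_betw_nth)
  from ex_bij_betw_reindex[OF this, of ?R]
  have multi: "multi_aut_equiv \<Sigma> (A, \<Phi>\<^sub>1, F\<^sub>1) (B, \<Phi>\<^sub>2, F\<^sub>2) \<longleftrightarrow>
      (\<exists>\<beta>. bij_betw \<beta> {..<?n} {..<?m} \<and> (\<forall>k\<in>{..<?n}. ?R (fs ! k) (gs ! \<beta> k)))"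
    by (simp add: multi_aut_equiv_def)
  have R: "equiv_code N x y (code_nth ?u k) (code_nth ?v l) \<longleftrightarrow> ?R (fs ! k) (gs ! l)"
    if k: "k < ?n" and l: "l < ?m" for k l
  proof (rule equiv_code_iff[OF \<Sigma> M1 _ M2 _ x' y' _ _ N])
    show "fs ! k \<in> F\<^sub>1" "gs ! l \<in> F\<^sub>2"
      using fs(2) gs(2) lengths k l nth_mem by metis+
    show "codes_interp \<Phi>\<^sub>1 (fs ! k) (code_nth ?u k)" "codes_interp \<Phi>\<^sub>2 (gs ! l) (code_nth ?v l)"
      using fs(3) gs(3) k l lengths by (auto simp: code_nth_list_decode list_all2_conv_all_nth)
  qed
  have code: "multi_equiv_code N x y \<longleftrightarrow> (\<exists>c < N ^ (N * N).
      bij_betw (digit N c 0) {..<?n} {..<?m} \<and> (\<forall>k\<in>{..<?n}. ?R (fs ! k) (gs ! digit N c 0 k)))"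
    unfolding multi_equiv_code_def bij_betw_lessThan_iff using R by blast
  show ?thesis
    unfolding multi code
  proof
    assume "\<exists>\<beta>. bij_betw \<beta> {..<?n} {..<?m} \<and> (\<forall>k\<in>{..<?n}. ?R (fs ! k) (gs ! \<beta> k))"
    then obtain \<beta> where \<beta>: "bij_betw \<beta> {..<?n} {..<?m}" "\<forall>k\<in>{..<?n}. ?R (fs ! k) (gs ! \<beta> k)"
      by blast
    \<comment> \<open>The coded family is constant in the row index; row 0 is the one read
      off.\<close>
    obtain c where c: "c < N ^ (N * N)" "\<And>i k. i < N \<Longrightarrow> k < N \<Longrightarrow> \<beta> k < N \<Longrightarrow> digit N c i k = \<beta> k"
      using digit_exists[of N "\<lambda>i. \<beta>"] N by auto
    have eq: "digit N c 0 k = \<beta> k" if "k \<in> {..<?n}" for k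
    proof (rule c(2))
      show "k < N" "0 < N"
        using that code_length_interps_le[of x] N by simp_all
      have "\<beta> k < ?m"
        using bij_betwE[OF \<beta>(1)] that by blast
      then show "\<beta> k < N"
        using code_length_interps_le[of y] N by simp
    qed
    then have "bij_betw (digit N c 0) {..<?n} {..<?m}"
      using \<beta>(1) bij_betw_cong[of "{..<?n}" "digit N c 0" \<beta>] by blast
    then show "\<exists>c < N ^ (N * N). bij_betw (digit N c 0) {..<?n} {..<?m} \<and>
        (\<forall>k\<in>{..<?n}. ?R (fs ! k) (gs ! digit N c 0 k))"
      using c(1) \<beta>(2) eq by auto
  qed blast
qed


section \<open>Codes of tables\<close>

lemma code_fst_encode_pair: "code_fst (encode_pair e d p) = e (fst p)"
  by (simp add: encode_pair_def split: prod.split)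

lemma code_snd_encode_pair: "code_snd (encode_pair e d p) = d (snd p)"
  by (simp add: encode_pair_def split: prod.split)

lemma list_decode_encode_list: "list_decode (encode_list e xs) = map e xs"
  by (simp add: encode_list_def)

lemma encode_list_id: "encode_list id = list_encode"
  by (simp add: fun_eq_iff encode_list_def)

lemmas decode_table =
  encode_table_def code_fst_encode_pair code_snd_encode_pair list_decode_encode_list encode_list_id

text \<open>Taking the set of images forgets the order of enumeration, which a table leaves
  open.\<close>

lemma lists_set_image:
  assumes "lists_set R S ts" and "\<And>z t. R z t \<Longrightarrow> g t = h z"
  shows "g ` set ts = h ` S"
proof -
  obtain zs where zs: "set zs = S" "list_all2 R zs ts"
    using assms(1) by (auto simp: lists_set_def)
  have "map g ts = map h zs"
    using zs(2) assms(2) by (auto simp: list_all2_conv_all_nth intro!: nth_equalityI)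
  then show ?thesis
    unfolding zs(1)[symmetric] by (metis list.set_map)
qed

lemma lists_set_eq:
  assumes "lists_set (=) S ts"
  shows "set ts = S"
  using lists_set_image[OF assms, of id id] by simp

lemma lists_set_map:
  assumes "lists_set R S ts" and "\<And>z t. R z t \<Longrightarrow> R' z (h t)"
  shows "lists_set R' S (map h ts)"
  using assms unfolding lists_set_def by (auto simp: list_all2_conv_all_nth)

lemma codes_multi_model_encode_table:
  assumes "tabulates \<Sigma> (A, \<Phi>, F) T"
  shows "codes_multi_model \<Sigma> (A, \<Phi>, F) (encode_table T)"
proof -
  obtain ct ot st its where T: "T = (ct, ot, st, its)" by (cases T)
  have ct: "lists_set (carrier_row A) (sorts \<Sigma>) ct" and ot: "lists_set (operation_row \<Sigma> A) (ops \<Sigma>) ot"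
    and st: "lists_set (symbol_row \<Phi>) (syms \<Phi>) st"
    and its: "lists_set (\<lambda>f. lists_set (relation_row f) (syms \<Phi>)) F its"
    using assms by (simp_all add: tabulates_def T)
  \<comment> \<open>Each equation is proved on the table itself, with \<open>fst\<close> and
    \<open>snd\<close> in the places of \<open>code_fst\<close> and \<open>code_snd\<close>;
    decoding then turns it into one about codes.\<close>
  have "(\<lambda>r. (fst r, set (snd r))) ` set ct = (\<lambda>i. (i, carr A i)) ` sorts \<Sigma>"
    by (rule lists_set_image[OF ct]) (auto simp: carrier_row_def lists_set_eq)
  moreover have "(\<lambda>r. (fst r, list_encode (fst (snd r)), fst (snd (snd r)),
        (\<lambda>e. prod_encode (list_encode (fst e), snd e)) ` set (snd (snd (snd r))))) ` set ot =
      (\<lambda>\<omega>. (\<omega>, list_encode (arg_sorts \<Sigma> \<omega>), res_sort \<Sigma> \<omega>,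
        (\<lambda>xs. prod_encode (list_encode xs, op_interp A \<omega> xs)) ` tuples (carr A) (arg_sorts \<Sigma> \<omega>))) ` ops \<Sigma>"
  proof (rule lists_set_image[OF ot])
    fix \<omega> r assume row: "operation_row \<Sigma> A \<omega> r"
    obtain \<omega>' "is" j t where r: "r = (\<omega>', is, j, t)" by (cases r)
    have t: "lists_set (\<lambda>xs r. r = (xs, op_interp A \<omega> xs)) (tuples (carr A) (arg_sorts \<Sigma> \<omega>)) t"
      using row by (simp add: operation_row_def r)
    have "(\<lambda>e. prod_encode (list_encode (fst e), snd e)) ` set t =
        (\<lambda>xs. prod_encode (list_encode xs, op_interp A \<omega> xs)) ` tuples (carr A) (arg_sorts \<Sigma> \<omega>)"
      by (rule lists_set_image[OF t]) simp
    then show "(fst r, list_encode (fst (snd r)), fst (snd (snd r)),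
        (\<lambda>e. prod_encode (list_encode (fst e), snd e)) ` set (snd (snd (snd r)))) =
      (\<omega>, list_encode (arg_sorts \<Sigma> \<omega>), res_sort \<Sigma> \<omega>,
        (\<lambda>xs. prod_encode (list_encode xs, op_interp A \<omega> xs)) ` tuples (carr A) (arg_sorts \<Sigma> \<omega>))"
      using row by (simp add: operation_row_def r)
  qed
  moreover have "(\<lambda>p. (fst p, list_encode (snd p))) ` set st =
      (\<lambda>\<phi>. (\<phi>, list_encode (rel_type \<Phi> \<phi>))) ` syms \<Phi>"
    by (rule lists_set_image[OF st]) (simp add: symbol_row_def)
  ultimately have "codes_structure \<Sigma> A \<Phi> (encode_table T)"
    by (simp add: codes_structure_def decode_table T image_image encode_pair_def split_beta)
  \<comment> \<open>Interpretations keep their positions: their list is mapped entry by entry, and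
    only the rows inside each one become a set.\<close>
  moreover have "lists_set (codes_interp \<Phi>) F (list_decode (interps_code (encode_table T)))"
    unfolding T decode_table snd_conv
  proof (rule lists_set_map[OF its])
    fix f rt assume rt: "lists_set (relation_row f) (syms \<Phi>) rt"
    have "(\<lambda>r. (fst r, list_encode ` set (snd r))) ` set rt = (\<lambda>\<phi>. (\<phi>, list_encode ` f \<phi>)) ` syms \<Phi>"
      by (rule lists_set_image[OF rt]) (auto simp: relation_row_def lists_set_eq)
    then show "codes_interp \<Phi> f (encode_list (encode_pair id (encode_list list_encode)) rt)"
      by (simp add: codes_interp_def decode_table image_image)
  qed
  ultimately show ?thesis
    by (simp add: codes_multi_model_def)
qed

theorem mainTheorem1:
  shows "\<exists>P. \<forall>(\<Sigma> :: (nat, nat) signature) (\<Theta> :: (nat, nat, nat) algebra set)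
            A (\<Phi>\<^sub>1 :: (nat, nat) rel_signature) F\<^sub>1 B (\<Phi>\<^sub>2 :: (nat, nat) rel_signature) F\<^sub>2 T\<^sub>1 T\<^sub>2.
     is_signature \<Sigma> \<and> is_variety \<Sigma> \<Theta> \<and> A \<in> \<Theta> \<and> B \<in> \<Theta> \<and>
     finite_multi_model \<Sigma> (A, \<Phi>\<^sub>1, F\<^sub>1) \<and> finite_multi_model \<Sigma> (B, \<Phi>\<^sub>2, F\<^sub>2) \<and>
     tabulates \<Sigma> (A, \<Phi>\<^sub>1, F\<^sub>1) T\<^sub>1 \<and> tabulates \<Sigma> (B, \<Phi>\<^sub>2, F\<^sub>2) T\<^sub>2 \<longrightarrow>
     computes P [encode_table T\<^sub>1, encode_table T\<^sub>2]
       (if multi_aut_equiv \<Sigma> (A, \<Phi>\<^sub>1, F\<^sub>1) (B, \<Phi>\<^sub>2, F\<^sub>2) then 1 else 0)"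
proof -
  \<comment> \<open>The base N = x + y + 1 is computed from the input, and the signature is read
    from the tables, so one program serves all signatures.\<close>
  have "decidable (Suc (Suc 0)) (\<lambda>xs. multi_equiv_code (Suc (hd xs + hd (tl xs))) (hd xs) (hd (tl xs)))"
    by (intro decidable_multi_equiv_code computable_basic)
  then obtain P where P: "\<And>xs. length xs = Suc (Suc 0) \<Longrightarrow>
      computes P xs (of_bool (multi_equiv_code (Suc (hd xs + hd (tl xs))) (hd xs) (hd (tl xs))))"
    unfolding decidable_def computable_def by blast
  show ?thesis
  proof (intro exI[of _ P] allI impI, elim conjE)
    fix \<Sigma> :: "(nat, nat) signature" and \<Theta> :: "(nat, nat, nat) algebra set"
      and A \<Phi>\<^sub>1 F\<^sub>1 B \<Phi>\<^sub>2 F\<^sub>2 T\<^sub>1 T\<^sub>2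
    assume \<Sigma>: "is_signature \<Sigma>"
      and M: "finite_multi_model \<Sigma> (A, \<Phi>\<^sub>1, F\<^sub>1)" "finite_multi_model \<Sigma> (B, \<Phi>\<^sub>2, F\<^sub>2)"
      and T: "tabulates \<Sigma> (A, \<Phi>\<^sub>1, F\<^sub>1) T\<^sub>1" "tabulates \<Sigma> (B, \<Phi>\<^sub>2, F\<^sub>2) T\<^sub>2"
    have M': "is_multi_model \<Sigma> (A, \<Phi>\<^sub>1, F\<^sub>1)" "is_multi_model \<Sigma> (B, \<Phi>\<^sub>2, F\<^sub>2)"
      using M by (simp_all add: finite_multi_model_def)
    let ?x = "encode_table T\<^sub>1" and ?y = "encode_table T\<^sub>2"
    have "multi_equiv_code (Suc (?x + ?y)) ?x ?y \<longleftrightarrow> multi_aut_equiv \<Sigma> (A, \<Phi>\<^sub>1, F\<^sub>1) (B, \<Phi>\<^sub>2, F\<^sub>2)"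
      using T by (intro multi_equiv_code_iff[OF \<Sigma> M'] codes_multi_model_encode_table) simp_all
    then show "computes P [?x, ?y]
        (if multi_aut_equiv \<Sigma> (A, \<Phi>\<^sub>1, F\<^sub>1) (B, \<Phi>\<^sub>2, F\<^sub>2) then 1 else 0)"
      using P[of "[?x, ?y]"] by (simp add: of_bool_def)
  qed
qed

end
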